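(* Let $J\in\mathbb{R}^{d\times d}$ be antisymmetric ($J^\top=-J$), let $\alpha\in\mathbb{R}$, let $M\in\mathbb{R}^{d\times d}$ be symmetric positive definite, let $l\in\mathbb{R}^d$, and let $\pi=\mathcal{N}(0,I)$ be the standard Gaussian measure on $\mathbb{R}^d$. Let $f(x)=x\cdot Mx+l\cdot x-\operatorname{Tr}M$ and $\mathcal{L}=-(I+\alpha J)x\cdot\nabla+\Delta$. Let $A=(I+\alpha J)^\top=I-\alpha J$. Then the unique mean-zero solution of the Poisson equation $$-\mathcal{L}\phi(x)=x\cdot Mx+l\cdot x-\operatorname{Tr}M,\qquad\pi(\phi)=0,$$ is given by $$\phi(x)=x\cdot Cx+D\cdot x-\operatorname{Tr}(C),$$ where $$C=\frac12\int_0^\infty e^{-As}Me^{-A^\top s}\,ds\qquad\text{and}\qquad D=A^{-1}l.$$ Moreover, the asymptotic variance is given by $$\sigma_f^2(\alpha)=\|M\|_F^2-\int_0^\infty e^{-2s}\left\|[M,e^{-\alpha Js}]\right\|_F^2\,ds+2\,l\cdot(I+\alpha^2J^\top J)^{-1}l.$$ In particular, $\sigma_f^2(\alpha)\le\sigma_f^2(0)$ for all $\alpha\in\mathbb{R}$.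
   Context: $\pi(\phi)=\int_{\mathbb{R}^d}\phi\,d\pi$. $\mathcal{L}$ is the infinitesimal generator of the nonsymmetric Ornstein-Uhlenbeck process $dX_t=-(I+\alpha J)X_t\,dt+\sqrt2\,dW_t$ on $\mathbb{R}^d$, where $W_t$ is a standard $d$-dimensional Brownian motion; its stationary distribution is $\pi$, independent of $\alpha$ and $J$. The constant $-\operatorname{Tr}M$ in $f$ is chosen so that $\pi(f)=0$. The asymptotic variance of $f$ (the variance of the limiting Gaussian in the central limit theorem for the time average $\frac1T\int_0^T f(X_t)\,dt$) is $\sigma_f^2(\alpha)=2\int_{\mathbb{R}^d}|\nabla\phi(x)|^2\,\pi(dx)=2\langle\phi,(-\mathcal{L})\phi\rangle_{L^2(\pi)}=2\langle\phi,f\rangle_{L^2(\pi)}$, where $\phi$ is the mean-zero solution of the Poisson equation. $\|B\|_F=\sqrt{\operatorname{Tr}[BB^\top]}$ is the Frobenius norm and $[B_1,B_2]=B_1B_2-B_2B_1$ is the commutator.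
   Formalization: The printed constants fail (d=1, J=0, l=0, M=m: C is m/2, not m/4; variance 2m², not m²); the formal theorem drops the 1/2 in C and doubles the M-part: 2‖M‖_F² − 2∫e^{-2s}‖[M,e^{-αJs}]‖_F² ds. Solutions are C² and π-integrable. *)

theory Defs
  imports "HOL-Probability.Probability"
begin

definition std_gaussian :: "(real ^ 'd) measure" where
  "std_gaussian = density lborel (\<lambda>x. ennreal (\<Prod>i\<in>UNIV. std_normal_density (x $ i)))"

definition grad :: "(real ^ 'd \<Rightarrow> real) \<Rightarrow> real ^ 'd \<Rightarrow> real ^ 'd" where
  "grad \<phi> x = (\<chi> i. frechet_derivative \<phi> (at x) (axis i 1))"

definition laplacian :: "(real ^ 'd \<Rightarrow> real) \<Rightarrow> real ^ 'd \<Rightarrow> real" where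
  "laplacian \<phi> x = (\<Sum>i\<in>UNIV. grad (\<lambda>y. grad \<phi> y $ i) x $ i)"

(* Differentiability is required explicitly: grad is an unspecified value at points
   where its argument is not differentiable. *)
definition twice_cont_diff :: "(real ^ 'd \<Rightarrow> real) \<Rightarrow> bool" where
  "twice_cont_diff \<phi> \<longleftrightarrow>
     \<phi> differentiable_on UNIV \<and>
     (\<forall>i. (\<lambda>x. grad \<phi> x $ i) differentiable_on UNIV \<and>
          continuous_on UNIV (grad (\<lambda>x. grad \<phi> x $ i)))"

(* Generator of dX = -(I + \<alpha> J) X dt + sqrt 2 dW. *)
definition ou_generator ::
    "real ^ 'd ^ 'd \<Rightarrow> real \<Rightarrow> (real ^ 'd \<Rightarrow> real) \<Rightarrow> real ^ 'd \<Rightarrow> real" where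
  "ou_generator J \<alpha> \<phi> x = - (((mat 1 + \<alpha> *\<^sub>R J) *v x) \<bullet> grad \<phi> x) + laplacian \<phi> x"

(* Classical solutions; integrability against the Gaussian is all that is needed for the
   mean to make sense, and no growth condition is imposed on the derivatives. *)
definition mean_zero_poisson_solution ::
    "real ^ 'd ^ 'd \<Rightarrow> real \<Rightarrow> (real ^ 'd \<Rightarrow> real) \<Rightarrow> (real ^ 'd \<Rightarrow> real) \<Rightarrow> bool" where
  "mean_zero_poisson_solution J \<alpha> f \<phi> \<longleftrightarrow>
     twice_cont_diff \<phi> \<and>
     (\<forall>x. - ou_generator J \<alpha> \<phi> x = f x) \<and>
     integrable std_gaussian \<phi> \<and> (\<integral>x. \<phi> x \<partial>std_gaussian) = 0"

definition asymptotic_variance ::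
    "real ^ 'd ^ 'd \<Rightarrow> (real ^ 'd \<Rightarrow> real) \<Rightarrow> real \<Rightarrow> real" where
  "asymptotic_variance J f \<alpha> =
     2 * (\<integral>x. (norm (grad (THE \<phi>. mean_zero_poisson_solution J \<alpha> f \<phi>) x))\<^sup>2 \<partial>std_gaussian)"

(* The type class function exp is not available on real ^ 'd ^ 'd, whose
   type class multiplication is componentwise. *)
definition mat_exp :: "real ^ 'd ^ 'd \<Rightarrow> real ^ 'd ^ 'd" where
  "mat_exp B = (\<Sum>n. (1 / fact n) *\<^sub>R (((**) B) ^^ n) (mat 1))"

definition frobenius_norm :: "real ^ 'd ^ 'd \<Rightarrow> real" where
  "frobenius_norm B = sqrt (trace (B ** transpose B))"

definition commutator :: "real ^ 'd ^ 'd \<Rightarrow> real ^ 'd ^ 'd \<Rightarrow> real ^ 'd ^ 'd" where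
  "commutator B\<^sub>1 B\<^sub>2 = B\<^sub>1 ** B\<^sub>2 - B\<^sub>2 ** B\<^sub>1"

end

theory Submission
  imports Defs "HOL-Real_Asymp.Real_Asymp"
begin

text \<open>
  Existence: a quadratic ansatz reduces the Poisson equation to the Lyapunov equation
  \<open>A C + C A\<^sup>T = M\<close> together with \<open>A D = l\<close>. Since \<open>e\<^sup>-\<^sup>s\<^sup>A\<close> is \<open>e\<^sup>-\<^sup>s\<close> times an orthogonal matrix, the
  integrand of \<open>C\<close> decays exponentially, and the Lyapunov equation is the fundamental theorem of
  calculus on the half line.

  Uniqueness: if \<open>h\<close> is \<open>C\<^sup>2\<close>, integrable and \<open>L h = 0\<close>, then \<open>L (G \<circ> h) = G'' (h) |\<nabla>h|\<^sup>2\<close> for every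
  \<open>G\<close>. Choosing \<open>G\<close> strictly convex of linear growth and integrating against the Gaussian times a radial
  cutoff moves all derivatives to the cutoff, because the antisymmetric drift is tangential to spheres.
  Removing the cutoff shows that \<open>\<nabla>h = 0\<close>.

  Variance: Gaussian moments give \<open>\<sigma>\<^sup>2 = 8 |C|\<^sup>2 + 2 |D|\<^sup>2\<close>, and pairing the Lyapunov equation with
  \<open>C\<close> gives \<open>2 |C|\<^sup>2 = Tr (C M)\<close>, where antisymmetry removes \<open>J\<close>. For orthogonal \<open>U\<close> one has
  \<open>|[M, U]|\<^sup>2 = 2 |M|\<^sup>2 - 2 Tr (M U M U\<^sup>T)\<close>, which turns \<open>Tr (C M)\<close> into the commutator integral.
\<close>

section \<open>The matrix exponential\<close>

text \<open>Type class multiplication on matrices is componentwise, so the algebra of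
  \<open>**\<close> has to be supplied separately. Bounded bilinearity yields the distributive laws,
  the product rule, continuity, and the interchange of \<open>**\<close> with series and
  integrals.\<close>

lemma bounded_bilinear_matrix_mult:
  "bounded_bilinear ((**) :: real^'m^'n \<Rightarrow> real^'k^'m \<Rightarrow> real^'k^'n)"
  unfolding bilinear_conv_bounded_bilinear [symmetric] bilinear_def
  by (auto intro!: linearI simp: vec_eq_iff matrix_matrix_mult_def algebra_simps
      sum.distrib sum_distrib_left)

lemma bounded_linear_transpose: "bounded_linear (transpose :: real^'m^'n \<Rightarrow> real^'n^'m)"
  unfolding linear_conv_bounded_linear [symmetric]
  by (auto intro!: linearI simp: vec_eq_iff transpose_def)

lemmas matrix_mult_simps =
  bounded_bilinear.add_left [OF bounded_bilinear_matrix_mult]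
  bounded_bilinear.add_right [OF bounded_bilinear_matrix_mult]
  bounded_bilinear.diff_left [OF bounded_bilinear_matrix_mult]
  bounded_bilinear.diff_right [OF bounded_bilinear_matrix_mult]
  bounded_bilinear.minus_left [OF bounded_bilinear_matrix_mult]
  bounded_bilinear.minus_right [OF bounded_bilinear_matrix_mult]
  bounded_bilinear.scaleR_left [OF bounded_bilinear_matrix_mult]
  bounded_bilinear.scaleR_right [OF bounded_bilinear_matrix_mult]
  bounded_bilinear.zero_left [OF bounded_bilinear_matrix_mult]
  bounded_bilinear.zero_right [OF bounded_bilinear_matrix_mult]

lemmas transpose_simps =
  linear_add [OF bounded_linear.linear [OF bounded_linear_transpose]]
  linear_diff [OF bounded_linear.linear [OF bounded_linear_transpose]]
  linear_neg [OF bounded_linear.linear [OF bounded_linear_transpose]]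
  linear_scale [OF bounded_linear.linear [OF bounded_linear_transpose]]
  transpose_mat

abbreviation mat_pow :: "real^'d^'d \<Rightarrow> nat \<Rightarrow> real^'d^'d" where
  "mat_pow B n \<equiv> (((**) B) ^^ n) (mat 1)"

lemma mat_pow_commute: "mat_pow B n ** B = B ** mat_pow B n"
  by (induction n) (simp_all add: matrix_mul_assoc [symmetric])

lemma mat_pow_scaleR: "mat_pow (c *\<^sub>R B) n = c ^ n *\<^sub>R mat_pow B n"
  by (induction n) (simp_all add: matrix_mult_simps)

lemma mat_pow_transpose: "mat_pow (transpose B) n = transpose (mat_pow B n)"
proof (induction n)
  case (Suc n)
  have "transpose (mat_pow B (Suc n)) = transpose (mat_pow B n ** B)"
    by (simp add: mat_pow_commute)
  then show ?case by (simp add: Suc matrix_transpose_mul)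
qed (simp add: transpose_mat)

text \<open>The sum of the absolute values of all entries dominates every row sum, so each further
  factor \<open>B\<close> costs at most one more factor of it.\<close>

lemma abs_mat_pow_le: "\<bar>mat_pow B n $ i $ j\<bar> \<le> (\<Sum>i\<in>UNIV. \<Sum>j\<in>UNIV. \<bar>B $ i $ j\<bar>) ^ n"
proof (induction n arbitrary: i j)
  case 0
  then show ?case by (simp add: mat_def)
next
  case (Suc n)
  let ?b = "\<Sum>i\<in>UNIV. \<Sum>j\<in>UNIV. \<bar>B $ i $ j\<bar>"
  have row: "(\<Sum>k\<in>UNIV. \<bar>B $ i $ k\<bar>) \<le> ?b"
    by (rule member_le_sum [where f = "\<lambda>i. \<Sum>k\<in>UNIV. \<bar>B $ i $ k\<bar>"]) (auto intro: sum_nonneg)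
  have b0: "0 \<le> ?b" by (intro sum_nonneg) auto
  have "\<bar>mat_pow B (Suc n) $ i $ j\<bar> \<le> (\<Sum>k\<in>UNIV. \<bar>B $ i $ k\<bar> * \<bar>mat_pow B n $ k $ j\<bar>)"
    by (simp add: matrix_matrix_mult_def sum_abs [THEN order_trans] abs_mult [symmetric])
  also have "\<dots> \<le> (\<Sum>k\<in>UNIV. \<bar>B $ i $ k\<bar> * ?b ^ n)"
    by (intro sum_mono mult_left_mono Suc) auto
  also have "\<dots> = (\<Sum>k\<in>UNIV. \<bar>B $ i $ k\<bar>) * ?b ^ n" by (simp add: sum_distrib_right)
  also have "\<dots> \<le> ?b * ?b ^ n" using row b0 by (intro mult_right_mono) auto
  finally show ?case by simp
qed

text \<open>The variable \<open>y\<close> makes this a power series with infinite radius of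
  convergence, the form that termwise differentiation requires. The case \<open>y = 1\<close> gives
  convergence of the exponential series.\<close>

lemma summable_mat_pow_entry:
  "summable (\<lambda>n. mat_pow B n $ i $ j / fact n * y ^ n)" for B :: "real^'d^'d" and y :: real
proof (rule summable_comparison_test)
  let ?b = "\<Sum>i\<in>UNIV. \<Sum>j\<in>UNIV. \<bar>B $ i $ j\<bar>"
  show "summable (\<lambda>n. (?b * \<bar>y\<bar>) ^ n /\<^sub>R fact n)" by (rule summable_exp_generic)
  show "\<exists>N. \<forall>n\<ge>N. norm (mat_pow B n $ i $ j / fact n * y ^ n) \<le> (?b * \<bar>y\<bar>) ^ n /\<^sub>R fact n"
    using abs_mat_pow_le [where B = B and i = i and j = j]
    by (intro exI [of _ 0])
      (auto simp: abs_mult power_abs power_mult_distrib field_simps intro!: mult_left_mono)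
qed

text \<open>Without convergence the infinite sum in \<open>mat_exp\<close> would be an unspecified
  value. Entrywise convergence suffices in finite dimension.\<close>

lemma mat_exp_sums: "(\<lambda>n. (1 / fact n) *\<^sub>R mat_pow B n) sums mat_exp B"
  for B :: "real^'d^'d"
proof -
  define L :: "real^'d^'d" where "L = (\<chi> i j. \<Sum>n. mat_pow B n $ i $ j / fact n)"
  have "(\<lambda>n. mat_pow B n $ i $ j / fact n) sums L $ i $ j" for i j
    using summable_mat_pow_entry [of B i j 1] by (simp add: L_def summable_sums)
  then have "(\<lambda>n. (1 / fact n) *\<^sub>R mat_pow B n) sums L"
    unfolding sums_def by (intro vec_tendstoI) simp
  then show ?thesis unfolding mat_exp_def by (simp add: sums_iff)
qed

lemma mat_exp_nth: "mat_exp B $ i $ j = (\<Sum>n. mat_pow B n $ i $ j / fact n)"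
  for B :: "real^'d^'d"
proof -
  have "bounded_linear (\<lambda>X::real^'d^'d. X $ i $ j)"
    by (rule bounded_linear_compose [OF bounded_linear_vec_nth bounded_linear_vec_nth])
  from bounded_linear.sums [OF this mat_exp_sums [of B]] show ?thesis by (simp add: sums_iff)
qed

lemma mat_exp_commute: "B ** mat_exp (s *\<^sub>R B) = mat_exp (s *\<^sub>R B) ** B"
proof -
  note bb = bounded_bilinear_matrix_mult [where 'n='a and 'm='a and 'k='a]
  have "(\<lambda>n. (1 / fact n) *\<^sub>R (B ** mat_pow (s *\<^sub>R B) n)) sums (B ** mat_exp (s *\<^sub>R B))"
    using bounded_linear.sums [OF bounded_bilinear.bounded_linear_right [OF bb]
            mat_exp_sums [of "s *\<^sub>R B"], of B]
    by (simp add: matrix_mult_simps)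
  moreover have "(\<lambda>n. (1 / fact n) *\<^sub>R (B ** mat_pow (s *\<^sub>R B) n)) sums (mat_exp (s *\<^sub>R B) ** B)"
    using bounded_linear.sums [OF bounded_bilinear.bounded_linear_left [OF bb]
            mat_exp_sums [of "s *\<^sub>R B"], of B]
    by (simp add: matrix_mult_simps mat_pow_scaleR mat_pow_commute)
  ultimately show ?thesis by (rule sums_unique2)
qed

lemma mat_exp_transpose: "mat_exp (transpose B) = transpose (mat_exp B)"
proof (rule sums_unique2)
  show "(\<lambda>n. (1 / fact n) *\<^sub>R mat_pow (transpose B) n) sums mat_exp (transpose B)"
    by (rule mat_exp_sums)
  show "(\<lambda>n. (1 / fact n) *\<^sub>R mat_pow (transpose B) n) sums transpose (mat_exp B)"
    using bounded_linear.sums [OF bounded_linear_transpose mat_exp_sums [of B]]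
    by (simp add: mat_pow_transpose transpose_simps)
qed

lemma mat_exp_0 [simp]: "mat_exp 0 = mat 1"
proof -
  have *: "mat_pow 0 n = (if n = 0 then mat 1 else (0::real^'d^'d))" for n
    by (cases n) (simp_all add: matrix_mult_simps)
  have "mat_exp 0 = (\<Sum>n\<in>{0}. (1 / fact n) *\<^sub>R (mat_pow 0 n :: real^'d^'d))"
    unfolding mat_exp_def by (rule suminf_finite) (auto simp: *)
  then show ?thesis by simp
qed

text \<open>Each entry of \<open>mat_exp (s *\<^sub>R B)\<close> is a scalar power series in
  \<open>s\<close>, so it can be differentiated term by term. The entries are then reassembled
  through the standard basis.\<close>

lemma has_vector_derivative_mat_exp:
  "((\<lambda>s. mat_exp (s *\<^sub>R B)) has_vector_derivative (B ** mat_exp (s *\<^sub>R B))) (at s)"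
proof -
  have entry: "((\<lambda>s. mat_exp (s *\<^sub>R B) $ i $ j) has_real_derivative (B ** mat_exp (s *\<^sub>R B)) $ i $ j) (at s)"
    for i j
  proof -
    let ?c = "\<lambda>j n. \<lambda>i. mat_pow B n $ i $ j / fact n"
    have "((\<lambda>s. \<Sum>n. ?c j n i * s ^ n) has_real_derivative (\<Sum>n. diffs (\<lambda>n. ?c j n i) n * s ^ n)) (at s)"
      by (rule termdiffs_strong_converges_everywhere) (rule summable_mat_pow_entry)
    moreover have "(\<Sum>n. ?c j n i * s ^ n) = mat_exp (s *\<^sub>R B) $ i $ j" for i j s
      by (simp add: mat_exp_nth mat_pow_scaleR mult.commute)
    note eq = this
    moreover have "(\<Sum>n. diffs (\<lambda>n. ?c j n i) n * s ^ n) = (B ** mat_exp (s *\<^sub>R B)) $ i $ j"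
    proof -
      \<comment> \<open>The factor \<open>Suc n\<close> from differentiation turns
        \<open>fact (Suc n)\<close> into \<open>fact n\<close>, and the power with exponent
        \<open>Suc n\<close> splits off one factor \<open>B\<close> on the left.\<close>
      have "diffs (\<lambda>n. ?c j n i) n = (\<Sum>k\<in>UNIV. B $ i $ k * ?c j n k)" for n
        by (simp add: diffs_def matrix_matrix_mult_def sum_divide_distrib sum_distrib_left
            del: of_nat_Suc)
      then have "(\<Sum>n. diffs (\<lambda>n. ?c j n i) n * s ^ n)
          = (\<Sum>n. \<Sum>k\<in>UNIV. B $ i $ k * (?c j n k * s ^ n))"
        by (simp add: sum_distrib_right mult.assoc)
      also have "\<dots> = (\<Sum>k\<in>UNIV. \<Sum>n. B $ i $ k * (?c j n k * s ^ n))"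
        by (intro suminf_sum summable_mult summable_mat_pow_entry)
      also have "\<dots> = (\<Sum>k\<in>UNIV. B $ i $ k * (\<Sum>n. ?c j n k * s ^ n))"
        by (intro sum.cong refl suminf_mult summable_mat_pow_entry)
      also have "\<dots> = (B ** mat_exp (s *\<^sub>R B)) $ i $ j"
        by (simp only: eq matrix_matrix_mult_def vec_lambda_beta)
      finally show ?thesis .
    qed
    ultimately show ?thesis by simp
  qed
  show ?thesis
    unfolding has_vector_derivative_def
  proof (subst has_derivative_componentwise_within, safe)
    fix b :: "real^'a^'a" assume "b \<in> Basis"
    then obtain i j where b: "b = axis i (axis j 1)" by (auto simp: Basis_vec_def)
    show "((\<lambda>s. mat_exp (s *\<^sub>R B) \<bullet> b) has_derivative
           (\<lambda>x. (x *\<^sub>R (B ** mat_exp (s *\<^sub>R B))) \<bullet> b)) (at s)"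
      using entry [of i j] by (simp add: b inner_axis has_field_derivative_def mult.commute [of _ "(B ** _) $ i $ j"])
  qed
qed

text \<open>The product has derivative zero, because \<open>B\<close> commutes with its exponential,
  and it is the identity at \<open>s = 0\<close>.\<close>

lemma mat_exp_inverse: "mat_exp (s *\<^sub>R B) ** mat_exp (- s *\<^sub>R B) = mat 1"
proof -
  define Y where "Y s = mat_exp (s *\<^sub>R B) ** mat_exp (s *\<^sub>R (- B))" for s
  have "(Y has_vector_derivative 0) (at s)" for s
  proof -
    have "mat_exp (s *\<^sub>R B) ** (- B ** mat_exp (s *\<^sub>R (- B)))
        + (B ** mat_exp (s *\<^sub>R B)) ** mat_exp (s *\<^sub>R (- B)) = 0"
      unfolding mat_exp_commute [of B s]
      by (simp only: matrix_mul_assoc matrix_mult_simps) simp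
    then show ?thesis
      using bounded_bilinear.has_vector_derivative [OF bounded_bilinear_matrix_mult
          has_vector_derivative_mat_exp [of B s] has_vector_derivative_mat_exp [of "- B" s]]
      unfolding Y_def by simp
  qed
  then obtain c where c: "Y s = c" for s
    using has_vector_derivative_zero_constant [of UNIV Y] by auto
  from c [of 0] c [of s] show ?thesis by (simp add: Y_def)
qed

text \<open>Multiplying a solution of \<open>X' = B X\<close> by the inverse exponential gives a
  constant. This identifies exponentials by checking a differential equation instead of multiplying
  series.\<close>

lemma mat_exp_unique:
  assumes X: "\<And>s. (X has_vector_derivative B ** X s) (at s)" and X0: "X 0 = mat 1"
  shows "X s = mat_exp (s *\<^sub>R B)"
proof -
  define Y where "Y s = mat_exp (s *\<^sub>R (- B)) ** X s" for s
  have "(Y has_vector_derivative 0) (at s)" for s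
  proof -
    have "mat_exp (s *\<^sub>R (- B)) ** (B ** X s) + (- B ** mat_exp (s *\<^sub>R (- B))) ** X s = 0"
      unfolding mat_exp_commute [of "- B" s]
      by (simp only: matrix_mul_assoc matrix_mult_simps) simp
    then show ?thesis
      using bounded_bilinear.has_vector_derivative [OF bounded_bilinear_matrix_mult
          has_vector_derivative_mat_exp [of "-B" s] X [of s]]
      unfolding Y_def by simp
  qed
  then obtain c where c: "Y s = c" for s
    using has_vector_derivative_zero_constant [of UNIV Y] by auto
  from c [of 0] c [of s] have "mat_exp (s *\<^sub>R (- B)) ** X s = mat 1"
    by (simp add: Y_def X0)
  then have "(mat_exp (s *\<^sub>R B) ** mat_exp (- s *\<^sub>R B)) ** X s = mat_exp (s *\<^sub>R B)"
    by (simp add: matrix_mul_assoc [symmetric])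
  then show ?thesis by (simp only: mat_exp_inverse matrix_mul_lid)
qed

section \<open>Frobenius inner product and antisymmetric matrices\<close>

text \<open>The inner product of the vector type is the Frobenius inner product, so the Euclidean
  norm of a matrix is its Frobenius norm.\<close>

lemma matrix_inner_eq_trace: "X \<bullet> Y = trace (X ** transpose Y)" for X Y :: "real^'m^'n"
  by (simp add: inner_vec_def trace_def matrix_matrix_mult_def transpose_def)

lemma frobenius_norm_sq: "(frobenius_norm B)\<^sup>2 = B \<bullet> B"
  unfolding frobenius_norm_def matrix_inner_eq_trace [symmetric] by simp

lemma matrix_inner_mult_left: "(X ** Y) \<bullet> Z = Y \<bullet> (transpose X ** Z)"
  for X Y Z :: "real^'d^'d"
  using trace_mul_sym [of X "Y ** transpose Z"]
  by (simp add: matrix_inner_eq_trace matrix_transpose_mul matrix_mul_assoc)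

lemma matrix_inner_mult_right: "(X ** Y) \<bullet> Z = X \<bullet> (Z ** transpose Y)"
  for X Y Z :: "real^'d^'d"
  by (simp add: matrix_inner_eq_trace matrix_transpose_mul matrix_mul_assoc)

text \<open>Moving \<open>J\<close> to the other argument changes its sign, so the number equals its
  own negative. The next lemma is the version for multiplication from the right.\<close>

lemma antisymmetric_inner_eq_0: "transpose J = - J \<Longrightarrow> C \<bullet> (J ** C) = 0" for C J :: "real^'d^'d"
  using matrix_inner_mult_left [of J C C] by (simp add: matrix_mult_simps inner_commute)

lemma antisymmetric_inner_eq_0': "transpose J = - J \<Longrightarrow> C \<bullet> (C ** J) = 0" for C J :: "real^'d^'d"
  using matrix_inner_mult_right [of C J C] by (simp add: matrix_mult_simps inner_commute)

lemma antisymmetric_quadratic_eq_0: "transpose J = - J \<Longrightarrow> x \<bullet> (J *v x) = 0"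
  for J :: "real^'d^'d"
proof -
  assume J: "transpose J = - J"
  have "x \<bullet> (J *v x) = (transpose J *v x) \<bullet> x"
    using dot_lmul_matrix [of x J x] by (simp add: inner_commute)
  also have "transpose J *v x = - (J *v x)"
    unfolding J by (simp add: vec_eq_iff matrix_vector_mult_def sum_negf)
  finally show ?thesis by (simp add: inner_commute)
qed

lemma antisymmetric_diag: "transpose J = - J \<Longrightarrow> J $ i $ i = 0" for J :: "real^'d^'d"
proof -
  assume J: "transpose J = - J"
  have "transpose J $ i $ i = (- J) $ i $ i" unfolding J ..
  then show ?thesis by (simp add: transpose_def)
qed

section \<open>The Lyapunov equation\<close>

text \<open>Interval integrals range over the open half line, so the endpoint \<open>a\<close> is
  first dropped as a null set.\<close>

lemma set_integral_FTC_atLeast: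
  fixes f F :: "real \<Rightarrow> 'a::euclidean_space"
  assumes F: "\<And>x. (F has_vector_derivative f x) (at x)"
    and f: "continuous_on UNIV f" "set_integrable lborel {a..} f"
    and L: "(F \<longlongrightarrow> L) at_top"
  shows "(LINT x:{a..}|lborel. f x) = L - F a"
proof -
  have null: "{a..} - {a<..} \<union> ({a<..} - {a..}) = {a}" by auto
  have sub: "set_integrable lborel {a<..} f"
    by (rule set_integrable_subset [OF f(2)]) auto
  have eq: "(LINT x:{a..}|lborel. f x) = (LINT x:{a<..}|lborel. f x)"
    by (rule set_integral_discrete_difference [of "{a}"]) (auto simp: null)
  have "(F \<longlongrightarrow> F a) (at a)"
    using has_vector_derivative_continuous [OF F [of a]] by (simp add: continuous_within)
  then have Fa: "(F \<longlongrightarrow> F a) (at_right a)" by (rule tendsto_mono [rotated]) (simp add: at_le)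
  have "(LBINT x=ereal a..\<infinity>. f x) = L - F a"
  proof (rule interval_integral_FTC_integrable)
    show "set_integrable lborel (einterval (ereal a) \<infinity>) f"
      using sub by simp
    show "isCont f x" for x using f(1) by (simp add: continuous_on_eq_continuous_at)
  qed (use F Fa L in \<open>auto simp: ereal_tendsto_simps\<close>)
  then show ?thesis by (simp add: eq interval_integral_to_infinity_eq)
qed

lemma exp_minus_2_integral:
  shows "set_integrable lborel {0..} (\<lambda>s::real. exp (- 2 * s))"
    and "(LINT s:{0..}|lborel. exp (- 2 * s)) = (1 / 2 :: real)"
proof -
  have "(\<lambda>s::real. exp (- 2 * s)) integrable_on {0..}"
    by (rule integrable_on_exp_minus_to_infinity) simp
  \<comment> \<open>Nonnegativity upgrades gauge integrability to absolute integrability.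
    Measurability of the integrand then permits the passage from the completed measure to
    \<open>lborel\<close>.\<close>
  then have "set_integrable lebesgue {0..} (\<lambda>s::real. exp (- 2 * s))"
    by (intro nonnegative_absolutely_integrable_1) auto
  then show int: "set_integrable lborel {0..} (\<lambda>s::real. exp (- 2 * s))"
    unfolding set_integrable_def by (subst (asm) integrable_completion) auto
  have lim: "((\<lambda>s::real. - exp (- 2 * s) / 2) \<longlongrightarrow> 0) at_top"
    by real_asymp
  have "(LINT s:{0..}|lborel. exp (- 2 * s)) = 0 - (- exp (- 2 * 0) / 2 :: real)"
    by (rule set_integral_FTC_atLeast [OF _ _ int lim])
      (auto intro!: derivative_eq_intros continuous_intros
        simp flip: has_real_derivative_iff_has_vector_derivative)
  then show "(LINT s:{0..}|lborel. exp (- 2 * s)) = (1 / 2 :: real)" by simp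
qed

lemma continuous_on_mat_exp: "continuous_on S (\<lambda>s. mat_exp (s *\<^sub>R B))"
  using has_vector_derivative_mat_exp [of B]
  by (intro continuous_at_imp_continuous_on ballI has_vector_derivative_continuous)

lemma mat_exp_antisymmetric:
  assumes J: "transpose J = - J"
  shows "transpose (mat_exp (s *\<^sub>R J)) = mat_exp (- s *\<^sub>R J)"
    and "mat_exp (s *\<^sub>R J) ** transpose (mat_exp (s *\<^sub>R J)) = mat 1"
    and "transpose (mat_exp (s *\<^sub>R J)) ** mat_exp (s *\<^sub>R J) = mat 1"
proof -
  show *: "transpose (mat_exp (s *\<^sub>R J)) = mat_exp (- s *\<^sub>R J)"
    by (simp add: mat_exp_transpose [symmetric] transpose_simps J)
  show "mat_exp (s *\<^sub>R J) ** transpose (mat_exp (s *\<^sub>R J)) = mat 1"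
    unfolding * by (rule mat_exp_inverse)
  show "transpose (mat_exp (s *\<^sub>R J)) ** mat_exp (s *\<^sub>R J) = mat 1"
    unfolding * using mat_exp_inverse [of "-s" J] by simp
qed

text \<open>The right-hand side solves the differential equation that characterizes the left-hand
  side. The matrix on the left is \<open>- A\<close>, so the decay of
  \<open>mat_exp (- s *\<^sub>R A)\<close> is separated from its rotation.\<close>

lemma mat_exp_identity_shift:
  "mat_exp (s *\<^sub>R (- mat 1 + \<alpha> *\<^sub>R J)) = exp (- s) *\<^sub>R mat_exp ((\<alpha> * s) *\<^sub>R J)"
proof (rule mat_exp_unique [symmetric, where s = s])
  fix s :: real
  have "((\<lambda>s. mat_exp (s *\<^sub>R (\<alpha> *\<^sub>R J))) has_vector_derivative
      (\<alpha> *\<^sub>R J) ** mat_exp (s *\<^sub>R (\<alpha> *\<^sub>R J))) (at s)"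
    by (rule has_vector_derivative_mat_exp)
  moreover have "((\<lambda>s. exp (- s)) has_real_derivative - exp (- s)) (at s)"
    by (auto intro!: derivative_eq_intros)
  ultimately have "((\<lambda>s. exp (- s) *\<^sub>R mat_exp (s *\<^sub>R (\<alpha> *\<^sub>R J))) has_vector_derivative
      exp (- s) *\<^sub>R ((\<alpha> *\<^sub>R J) ** mat_exp (s *\<^sub>R (\<alpha> *\<^sub>R J)))
        + (- exp (- s)) *\<^sub>R mat_exp (s *\<^sub>R (\<alpha> *\<^sub>R J))) (at s)"
    by (intro has_vector_derivative_scaleR)
  then show "((\<lambda>s. exp (- s) *\<^sub>R mat_exp ((\<alpha> * s) *\<^sub>R J)) has_vector_derivative
      (- mat 1 + \<alpha> *\<^sub>R J) ** (exp (- s) *\<^sub>R mat_exp ((\<alpha> * s) *\<^sub>R J))) (at s)"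
    by (simp add: matrix_mult_simps mult.commute scaleR_right_diff_distrib)
qed simp

lemma norm_orthogonal_mult:
  fixes U X :: "real^'d^'d"
  assumes "transpose U ** U = mat 1"
  shows "norm (U ** X) = norm X" "norm (X ** transpose U) = norm X"
proof -
  show "norm (U ** X) = norm X"
    by (simp add: norm_eq matrix_inner_mult_left matrix_mul_assoc assms)
  show "norm (X ** transpose U) = norm X"
    using matrix_inner_mult_right [of X "transpose U" "X ** transpose U"]
    by (simp add: norm_eq matrix_mul_assoc [symmetric] assms)
qed

context
  fixes J M A :: "real^'d^'d" and \<alpha> :: real and Z C
  assumes J: "transpose J = - J" and A: "A = transpose (mat 1 + \<alpha> *\<^sub>R J)"
  defines "Z \<equiv> \<lambda>s. mat_exp (- s *\<^sub>R A) ** M ** mat_exp (- s *\<^sub>R transpose A)"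
  defines "C \<equiv> LINT s:{0..}|lborel. Z s"
begin

lemma drift_transpose: "A = mat 1 - \<alpha> *\<^sub>R J" "transpose A = mat 1 + \<alpha> *\<^sub>R J"
  by (simp_all add: A transpose_simps J)

lemma lyapunov_integrand:
  "Z s = exp (- 2 * s) *\<^sub>R (mat_exp ((\<alpha> * s) *\<^sub>R J) ** M ** transpose (mat_exp ((\<alpha> * s) *\<^sub>R J)))"
proof -
  have 1: "mat_exp (- s *\<^sub>R A) = exp (- s) *\<^sub>R mat_exp ((\<alpha> * s) *\<^sub>R J)"
    using mat_exp_identity_shift [of s \<alpha> J] by (simp add: drift_transpose algebra_simps)
  have 2: "mat_exp (- s *\<^sub>R transpose A) = transpose (mat_exp (- s *\<^sub>R A))"
    by (simp add: mat_exp_transpose [symmetric] transpose_simps)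
  show ?thesis
    unfolding Z_def 2 unfolding 1
    by (simp add: matrix_mult_simps transpose_simps exp_add [symmetric])
qed

text \<open>Multiplication by an orthogonal matrix on either side is an isometry for the Frobenius
  norm. The resulting exact decay gives both integrability of \<open>Z\<close> on the half line and
  its limit 0 at infinity.\<close>

lemma norm_lyapunov_integrand: "norm (Z s) = exp (- 2 * s) * norm M"
  using mat_exp_antisymmetric(3) [OF J]
  by (simp add: lyapunov_integrand norm_orthogonal_mult)

lemma continuous_on_lyapunov_integrand: "continuous_on S Z"
proof -
  have "continuous_on S (\<lambda>s. mat_exp (s *\<^sub>R (- A)) ** M ** mat_exp (s *\<^sub>R (- transpose A)))"
    by (intro bounded_bilinear.continuous_on [OF bounded_bilinear_matrix_mult]
        continuous_on_mat_exp continuous_on_const)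
  then show ?thesis by (simp add: Z_def)
qed

lemma set_integrable_lyapunov_integrand: "set_integrable lborel {0..} Z"
proof (rule set_integrable_bound)
  show "set_integrable lborel {0..} (\<lambda>s. exp (- 2 * s) * norm M)"
    using exp_minus_2_integral(1) by simp
  show "set_borel_measurable lborel {0..} Z"
    using borel_measurable_continuous_on_indicator [OF _ continuous_on_lyapunov_integrand]
    by (simp add: set_borel_measurable_def)
qed (simp add: norm_lyapunov_integrand)

text \<open>The integrand satisfies \<open>Z' = - (A Z + Z A^T)\<close>. Integrating over the half
  line gives \<open>- M\<close> on the left, since \<open>Z 0 = M\<close> and \<open>Z\<close>
  vanishes at infinity. On the right, the bounded linear map \<open>X -> A X + X A^T\<close> comes
  out of the integral.\<close>

lemma lyapunov_equation: "A ** C + C ** transpose A = M"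
proof -
  have Z': "(Z has_vector_derivative - (A ** Z s + Z s ** transpose A)) (at s)" for s
  proof -
    let ?E = "\<lambda>B s. mat_exp (s *\<^sub>R (- B))"
    have E: "(?E B has_vector_derivative - (B ** ?E B s)) (at s)" for B s
      using has_vector_derivative_mat_exp [of "- B" s] by (simp add: matrix_mult_simps)
    have comm: "B ** ?E B s = ?E B s ** B" for B s
      using mat_exp_commute [of "- B" s] by (simp add: matrix_mult_simps)
    have "((\<lambda>s. ?E A s ** M) has_vector_derivative - (A ** ?E A s) ** M) (at s)"
      using bounded_bilinear.has_vector_derivative [OF bounded_bilinear_matrix_mult E
          has_vector_derivative_const [of M]]
      by (simp add: matrix_mult_simps)
    from bounded_bilinear.has_vector_derivative [OF bounded_bilinear_matrix_mult this E [of "transpose A"]]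
    show ?thesis
      unfolding comm [of "transpose A"]
      by (simp add: Z_def [abs_def] matrix_mult_simps matrix_mul_assoc algebra_simps)
  qed
  have lin: "bounded_linear (\<lambda>X. A ** X + X ** transpose A)"
    using bounded_bilinear_matrix_mult
    by (intro bounded_linear_add bounded_bilinear.bounded_linear_right
        bounded_bilinear.bounded_linear_left)
  note int = set_integrable_lyapunov_integrand
  have lim: "(Z \<longlongrightarrow> 0) at_top"
  proof (rule Lim_null_comparison)
    show "\<forall>\<^sub>F s in at_top. norm (Z s) \<le> exp (- 2 * s) * norm M"
      by (simp add: norm_lyapunov_integrand)
    show "((\<lambda>s. exp (- 2 * s) * norm M) \<longlongrightarrow> 0) at_top" by real_asymp
  qed
  have iZ: "integrable lborel (\<lambda>s. indicator {0..} s *\<^sub>R Z s)"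
    using int by (simp add: set_integrable_def)
  have ind: "indicator {0..} s *\<^sub>R - (A ** Z s + Z s ** transpose A)
      = - (A ** (indicator {0..} s *\<^sub>R Z s) + (indicator {0..} s *\<^sub>R Z s) ** transpose A)" for s :: real
    by (simp add: matrix_mult_simps scaleR_add_right scaleR_right_diff_distrib)
  have "(LINT s:{0..}|lborel. - (A ** Z s + Z s ** transpose A)) = 0 - Z 0"
  proof (rule set_integral_FTC_atLeast [OF Z' _ _ lim])
    show "continuous_on UNIV (\<lambda>s. - (A ** Z s + Z s ** transpose A))"
      by (intro continuous_intros bounded_bilinear.continuous_on [OF bounded_bilinear_matrix_mult]
          continuous_on_lyapunov_integrand)
    show "set_integrable lborel {0..} (\<lambda>s. - (A ** Z s + Z s ** transpose A))"
      unfolding set_integrable_def ind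
      by (rule integrable_minus [OF integrable_bounded_linear [OF lin iZ]])
  qed
  moreover have "(LINT s:{0..}|lborel. - (A ** Z s + Z s ** transpose A))
      = - (A ** C + C ** transpose A)"
    unfolding set_lebesgue_integral_def ind integral_minus integral_bounded_linear [OF lin iZ]
    by (simp only: C_def set_lebesgue_integral_def)
  ultimately have "A ** C + C ** transpose A = Z 0"
    by (simp only: diff_0 neg_equal_iff_equal)
  then show ?thesis by (simp add: Z_def)
qed

text \<open>With \<open>U = mat_exp ((\<alpha> * s) *\<^sub>R J)\<close> the exponential in the
  commutator is the transpose of \<open>U\<close>. Expanding the square leaves
  \<open>2 |M|^2\<close> minus twice the inner product of \<open>U M U^T\<close> with
  \<open>M\<close>. After weighting by \<open>exp (- 2 * s)\<close> the latter is
  \<open>Z s \<bullet> M\<close>, and the weight itself integrates to 1/2.\<close>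

lemma lyapunov_inner:
  "C \<bullet> M = M \<bullet> M / 2
    - (LINT s:{0..}|lborel. exp (- 2 * s) * (frobenius_norm (commutator M (mat_exp (- (\<alpha> * s) *\<^sub>R J))))\<^sup>2) / 2"
proof -
  let ?K = "\<lambda>s. exp (- 2 * s) * (frobenius_norm (commutator M (mat_exp (- (\<alpha> * s) *\<^sub>R J))))\<^sup>2"
  have pt: "?K s = 2 * (M \<bullet> M) * exp (- 2 * s) - 2 * (Z s \<bullet> M)" for s
  proof -
    define U where "U = mat_exp ((\<alpha> * s) *\<^sub>R J)"
    have U: "transpose U ** U = mat 1" "U ** transpose U = mat 1"
      using mat_exp_antisymmetric [OF J] by (simp_all add: U_def)
    have c: "commutator M (mat_exp (- (\<alpha> * s) *\<^sub>R J)) = M ** transpose U - transpose U ** M"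
      using mat_exp_antisymmetric(1) [OF J, of "\<alpha> * s"] by (simp add: commutator_def U_def)
    have 1: "(M ** transpose U) \<bullet> (M ** transpose U) = M \<bullet> M"
      using norm_orthogonal_mult(2) [OF U(1), of M] by (simp add: norm_eq)
    have 2: "(transpose U ** M) \<bullet> (transpose U ** M) = M \<bullet> M"
      using norm_orthogonal_mult(1) [of "transpose U" M] U by (simp add: norm_eq)
    have 3: "(transpose U ** M) \<bullet> (M ** transpose U) = M \<bullet> (U ** M ** transpose U)"
      by (simp add: matrix_inner_mult_left matrix_mul_assoc)
    have eq: "(frobenius_norm (commutator M (mat_exp (- (\<alpha> * s) *\<^sub>R J))))\<^sup>2
        = 2 * (M \<bullet> M) - 2 * ((U ** M ** transpose U) \<bullet> M)"
      unfolding frobenius_norm_sq c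
      using 1 2 3 by (simp add: inner_diff_left inner_diff_right inner_commute)
    show ?thesis
      unfolding eq by (simp add: lyapunov_integrand U_def [symmetric] algebra_simps)
  qed
  have iZ: "integrable lborel (\<lambda>s. indicator {0..} s *\<^sub>R Z s)"
    using set_integrable_lyapunov_integrand by (simp add: set_integrable_def)
  have "set_integrable lborel {0..} (\<lambda>s. Z s \<bullet> M)"
    "(LINT s:{0..}|lborel. Z s \<bullet> M) = C \<bullet> M"
    using integrable_bounded_linear [OF bounded_linear_inner_left iZ, of M]
      integral_bounded_linear [OF bounded_linear_inner_left iZ, of M]
    by (simp_all add: set_integrable_def set_lebesgue_integral_def C_def)
  then have "(LINT s:{0..}|lborel. ?K s) = 2 * (M \<bullet> M) * (1 / 2) - 2 * (C \<bullet> M)"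
    unfolding pt using exp_minus_2_integral
    by (subst set_integral_diff) auto
  then show ?thesis by (simp add: field_simps)
qed

text \<open>In the inner product of \<open>C\<close> with the Lyapunov equation the two terms with
  \<open>J\<close> vanish by antisymmetry, and the two identity parts contribute
  \<open>C \<bullet> C\<close> each.\<close>

lemma lyapunov_inner_self: "C \<bullet> M = 2 * (C \<bullet> C)"
proof -
  have "C \<bullet> M = C \<bullet> (A ** C + C ** transpose A)" by (simp add: lyapunov_equation)
  also have "\<dots> = 2 * (C \<bullet> C)"
    using antisymmetric_inner_eq_0 [OF J, of C] antisymmetric_inner_eq_0' [OF J, of C]
    unfolding drift_transpose(2) unfolding drift_transpose(1)
    by (simp only: matrix_mult_simps matrix_mul_lid matrix_mul_rid inner_add_right
        inner_diff_right inner_scaleR_right)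
  finally show ?thesis .
qed

lemma transpose_lyapunov: "transpose M = M \<Longrightarrow> transpose C = C"
proof -
  assume M: "transpose M = M"
  have tZ: "transpose (Z s) = Z s" for s
    by (simp add: lyapunov_integrand transpose_simps matrix_transpose_mul M matrix_mul_assoc)
  have iZ: "integrable lborel (\<lambda>s. indicator {0..} s *\<^sub>R Z s)"
    using set_integrable_lyapunov_integrand by (simp add: set_integrable_def)
  from integral_bounded_linear [OF bounded_linear_transpose iZ] show ?thesis
    by (simp add: transpose_simps tZ C_def set_lebesgue_integral_def)
qed

end

section \<open>Gaussian moments\<close>

definition gaussian_density :: "real ^ 'd \<Rightarrow> real" where
  "gaussian_density x = (\<Prod>i\<in>UNIV. std_normal_density (x $ i))"

lemma gaussian_density_eq:
  "gaussian_density (x :: real^'d) = (1 / sqrt (2 * pi)) ^ CARD('d) * exp (- (x \<bullet> x) / 2)"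
  by (simp add: gaussian_density_def std_normal_density_def prod.distrib exp_sum [symmetric]
      inner_vec_def power2_eq_square sum_divide_distrib sum_negf prod_dividef power_divide)

lemma gaussian_density_pos: "0 < gaussian_density x"
  unfolding gaussian_density_def by (rule prod_pos) (simp add: normal_density_pos)

lemma measurable_gaussian_density [measurable]: "gaussian_density \<in> borel_measurable borel"
  unfolding gaussian_density_eq [abs_def] by simp

lemma std_gaussian_eq: "std_gaussian = density lborel (\<lambda>x. ennreal (gaussian_density x))"
  by (simp add: std_gaussian_def gaussian_density_def)

lemma sets_std_gaussian [measurable_cong, simp]: "sets std_gaussian = sets borel"
  by (simp add: std_gaussian_eq)

lemma space_std_gaussian [simp]: "space std_gaussian = UNIV"
  by (simp add: std_gaussian_eq)

lemma integrable_std_gaussian_iff: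
  fixes g :: "real^'d \<Rightarrow> real"
  assumes [measurable]: "g \<in> borel_measurable borel"
  shows "integrable std_gaussian g \<longleftrightarrow> integrable lborel (\<lambda>x. gaussian_density x * g x)"
  unfolding std_gaussian_eq
  by (subst integrable_density) (auto simp: gaussian_density_pos less_imp_le)

lemma integral_std_gaussian:
  fixes g :: "real^'d \<Rightarrow> real"
  assumes [measurable]: "g \<in> borel_measurable borel"
  shows "(\<integral>x. g x \<partial>std_gaussian) = (\<integral>x. gaussian_density x * g x \<partial>lborel)"
  unfolding std_gaussian_eq
  by (subst integral_density) (auto simp: gaussian_density_pos less_imp_le)

lemma bij_betw_axis_Basis: "bij_betw (\<lambda>i. axis i 1) UNIV (Basis :: (real^'d) set)"
  by (auto simp: bij_betw_def inj_on_def axis_eq_axis Basis_vec_def)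

text \<open>Tonelli's theorem in coordinates. Working with nonnegative integrals delivers
  integrability of the moments together with their values.\<close>

lemma nn_integral_std_gaussian_prod:
  fixes g :: "'d::finite \<Rightarrow> real \<Rightarrow> real"
  assumes [measurable]: "\<And>i. g i \<in> borel_measurable borel" and nonneg: "\<And>i t. 0 \<le> g i t"
  shows "(\<integral>\<^sup>+x. ennreal (\<Prod>i\<in>UNIV. g i (x $ i)) \<partial>std_gaussian)
    = (\<Prod>i\<in>UNIV. \<integral>\<^sup>+t. ennreal (std_normal_density t * g i t) \<partial>lborel)"
proof -
  let ?e = "\<lambda>i::'d. axis i 1 :: real^'d"
  \<comment> \<open>The product formula for \<open>lborel\<close> indexes its factors by basis
    vectors, so each basis vector has to be translated back to its coordinate.\<close>
  let ?inv = "the_inv ?e"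
  define F where "F b t = ennreal (std_normal_density t * g (?inv b) t)" for b t
  have inj: "inj ?e" by (auto simp: inj_on_def axis_eq_axis)
  have F: "F (?e i) t = ennreal (std_normal_density t * g i t)" for i t
    by (simp add: F_def the_inv_f_f [OF inj])
  have [measurable]: "F b \<in> borel_measurable borel" for b
    unfolding F_def [abs_def] by measurable
  have "(\<integral>\<^sup>+x. ennreal (\<Prod>i\<in>UNIV. g i (x $ i)) \<partial>std_gaussian)
      = (\<integral>\<^sup>+x. ennreal (gaussian_density x) * ennreal (\<Prod>i\<in>UNIV. g i (x $ i)) \<partial>lborel)"
    unfolding std_gaussian_eq by (subst nn_integral_density) auto
  also have "\<dots> = (\<integral>\<^sup>+x. (\<Prod>b\<in>Basis. F b (x \<bullet> b)) \<partial>lborel)"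
  proof (rule nn_integral_cong)
    fix x :: "real^'d"
    have "(\<Prod>b\<in>Basis. F b (x \<bullet> b)) = (\<Prod>i\<in>UNIV. F (?e i) (x \<bullet> ?e i))"
      by (rule prod.reindex_bij_betw [OF bij_betw_axis_Basis, symmetric])
    also have "\<dots> = (\<Prod>i\<in>UNIV. ennreal (std_normal_density (x $ i) * g i (x $ i)))"
      by (simp add: F inner_axis)
    also have "\<dots> = ennreal (\<Prod>i\<in>UNIV. std_normal_density (x $ i) * g i (x $ i))"
      by (simp add: prod_ennreal nonneg)
    finally show "ennreal (gaussian_density x) * ennreal (\<Prod>i\<in>UNIV. g i (x $ i))
        = (\<Prod>b\<in>Basis. F b (x \<bullet> b))"
      by (simp add: gaussian_density_def prod.distrib ennreal_mult prod_nonneg nonneg)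
  qed
  also have "\<dots> = (\<Prod>b\<in>Basis. \<integral>\<^sup>+t. F b t \<partial>lborel)"
    by (rule nn_integral_lborel_prod) auto
  also have "\<dots> = (\<Prod>i\<in>UNIV. \<integral>\<^sup>+t. F (?e i) t \<partial>lborel)"
    by (rule prod.reindex_bij_betw [OF bij_betw_axis_Basis, symmetric])
  finally show ?thesis by (simp add: F)
qed

lemma nn_integral_std_normal_moments:
  "(\<integral>\<^sup>+t. ennreal (std_normal_density t) \<partial>lborel) = 1"
  "(\<integral>\<^sup>+t. ennreal (std_normal_density t * t\<^sup>2) \<partial>lborel) = 1"
  using std_normal_moment_even [of 0] std_normal_moment_even [of 1]
  by (auto simp: has_bochner_integral_iff nn_integral_eq_integral)

lemma prob_space_std_gaussian: "prob_space (std_gaussian :: (real^'d) measure)"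
proof
  have "emeasure (std_gaussian :: (real^'d) measure) (space std_gaussian)
      = (\<integral>\<^sup>+x. ennreal (\<Prod>i\<in>(UNIV::'d set). 1) \<partial>(std_gaussian :: (real^'d) measure))"
    by simp
  also have "\<dots> = 1"
    by (subst nn_integral_std_gaussian_prod) (simp_all add: nn_integral_std_normal_moments)
  finally show "emeasure (std_gaussian :: (real^'d) measure) (space std_gaussian) = 1" .
qed

lemma std_gaussian_coordinate_sq:
  "integrable std_gaussian (\<lambda>x::real^'d. (x $ k)\<^sup>2)"
  "(\<integral>x. (x $ k)\<^sup>2 \<partial>(std_gaussian :: (real^'d) measure)) = 1"
proof -
  have "(\<integral>\<^sup>+x. ennreal ((x $ k)\<^sup>2) \<partial>(std_gaussian :: (real^'d) measure))
      = (\<integral>\<^sup>+x. ennreal (\<Prod>i\<in>UNIV. if i = k then (x $ i)\<^sup>2 else 1) \<partial>(std_gaussian :: (real^'d) measure))"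
    by (simp add: prod.delta)
  also have "\<dots> = (\<Prod>i::'d\<in>UNIV. \<integral>\<^sup>+t. ennreal (std_normal_density t * (if i = k then t\<^sup>2 else 1)) \<partial>lborel)"
    by (rule nn_integral_std_gaussian_prod) auto
  also have "\<dots> = (\<Prod>i::'d\<in>UNIV. 1)"
  proof (rule prod.cong)
    show "(\<integral>\<^sup>+t. ennreal (std_normal_density t * (if i = k then t\<^sup>2 else 1)) \<partial>lborel) = 1" for i
      by (cases "i = k") (simp_all add: nn_integral_std_normal_moments)
  qed simp
  finally have "(\<integral>\<^sup>+x. ennreal ((x $ k)\<^sup>2) \<partial>(std_gaussian :: (real^'d) measure)) = ennreal 1" by simp
  from nn_integral_eq_integrable [THEN iffD1, OF _ _ _ this]
  show "integrable std_gaussian (\<lambda>x::real^'d. (x $ k)\<^sup>2)"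
    "(\<integral>x. (x $ k)\<^sup>2 \<partial>(std_gaussian :: (real^'d) measure)) = 1"
    by auto
qed

text \<open>Changing the sign of one coordinate preserves the Gaussian measure, which makes moments
  that are odd in that coordinate vanish.\<close>

definition reflect_coordinate :: "'d \<Rightarrow> real^'d \<Rightarrow> real^'d" where
  "reflect_coordinate k x = (\<chi> i. if i = k then - (x $ i) else x $ i)"

text \<open>The reflection is a diagonal map with entries 1 and -1, so the Jacobian factor in the
  change of variables is 1.\<close>

lemma lborel_distr_reflect_coordinate: "distr lborel borel (reflect_coordinate k) = lborel"
proof -
  let ?c = "\<lambda>j. if j = axis k 1 then - 1 else 1 :: real"
  have "(\<Sum>j\<in>Basis. (?c j * (x \<bullet> j)) *\<^sub>R j) = reflect_coordinate k x" for x
  proof -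
    have "(\<Sum>j\<in>Basis. (?c j * (x \<bullet> j)) *\<^sub>R j)
        = (\<Sum>i\<in>UNIV. ((if i = k then - 1 else 1) * x $ i) *\<^sub>R axis i 1)"
      by (subst sum.reindex_bij_betw [OF bij_betw_axis_Basis, symmetric])
        (simp add: inner_axis axis_eq_axis)
    also have "\<dots> = reflect_coordinate k x"
      by (auto simp: vec_eq_iff reflect_coordinate_def axis_def if_distrib cong: if_cong)
    finally show ?thesis .
  qed
  moreover have "(\<Prod>j\<in>(Basis::(real^'a) set). \<bar>?c j\<bar>) = 1"
    by (rule prod.neutral) auto
  ultimately show ?thesis
    using lborel_affine_euclidean [of ?c "0 :: real^'a"] by (simp add: density_1 cong: if_cong)
qed

lemma integral_std_gaussian_reflect:
  fixes g :: "real^'d \<Rightarrow> real"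
  assumes [measurable]: "g \<in> borel_measurable borel"
  shows "(\<integral>x. g (reflect_coordinate k x) \<partial>std_gaussian) = (\<integral>x. g x \<partial>std_gaussian)"
proof -
  have "continuous_on UNIV (\<lambda>x::real^'d. if i = k then - x $ i else x $ i)" for i
    by (cases "i = k") (auto intro!: continuous_intros)
  then have [measurable]: "reflect_coordinate k \<in> borel_measurable borel"
    unfolding reflect_coordinate_def [abs_def]
    by (intro borel_measurable_continuous_onI continuous_on_vec_lambda)
  have dens: "gaussian_density (reflect_coordinate k x) = gaussian_density x" for x
    unfolding gaussian_density_def reflect_coordinate_def
    by (intro prod.cong) (auto simp: std_normal_density_def)
  have "(\<integral>x. g x \<partial>std_gaussian)
      = (\<integral>x. gaussian_density x * g x \<partial>distr lborel borel (reflect_coordinate k))"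
    by (simp add: integral_std_gaussian lborel_distr_reflect_coordinate)
  also have "\<dots> = (\<integral>x. gaussian_density x * g (reflect_coordinate k x) \<partial>lborel)"
    by (subst integral_distr) (auto simp: dens)
  finally show ?thesis by (simp add: integral_std_gaussian)
qed

text \<open>Integrability follows by comparison with the sum of squares. For distinct indices,
  reflecting coordinate \<open>i\<close> shows that the integral equals its own negative.\<close>

lemma std_gaussian_coordinate_mult:
  "integrable std_gaussian (\<lambda>x::real^'d. x $ i * x $ j)"
  "(\<integral>x. x $ i * x $ j \<partial>(std_gaussian :: (real^'d) measure)) = (if i = j then 1 else 0)"
proof -
  have "\<bar>u * v\<bar> \<le> u\<^sup>2 + v\<^sup>2" for u v :: real
    using sum_squares_bound [of "\<bar>u\<bar>" "\<bar>v\<bar>"] mult_nonneg_nonneg [OF abs_ge_zero [of u] abs_ge_zero [of v]]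
    unfolding abs_mult power2_abs by linarith
  then have bound: "norm (x $ i * x $ j) \<le> norm ((x $ i)\<^sup>2 + (x $ j)\<^sup>2)" for x :: "real^'d"
    by simp
  have "integrable std_gaussian (\<lambda>x::real^'d. (x $ i)\<^sup>2 + (x $ j)\<^sup>2)"
    by (intro Bochner_Integration.integrable_add std_gaussian_coordinate_sq)
  then show "integrable std_gaussian (\<lambda>x::real^'d. x $ i * x $ j)"
    by (rule Bochner_Integration.integrable_bound) (measurable, intro AE_I2 bound)
  show "(\<integral>x. x $ i * x $ j \<partial>(std_gaussian :: (real^'d) measure)) = (if i = j then 1 else 0)"
  proof (cases "i = j")
    case True
    then show ?thesis using std_gaussian_coordinate_sq(2) [of j] by (simp add: power2_eq_square)
  next
    case False
    then show ?thesis
      using integral_std_gaussian_reflect [of "\<lambda>x. x $ i * x $ j" i]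
      by (simp add: reflect_coordinate_def)
  qed
qed

lemma std_gaussian_coordinate:
  "integrable std_gaussian (\<lambda>x::real^'d. x $ i)"
  "(\<integral>x. x $ i \<partial>(std_gaussian :: (real^'d) measure)) = 0"
proof -
  have "\<bar>u\<bar> \<le> 1 + u\<^sup>2" for u :: real
    using sum_squares_bound [of "\<bar>u\<bar>" 1] by (simp add: power2_eq_square)
  then have bound: "norm (x $ i) \<le> norm (1 + (x $ i)\<^sup>2)" for x :: "real^'d"
    by simp
  interpret prob_space "std_gaussian :: (real^'d) measure" by (rule prob_space_std_gaussian)
  have "integrable std_gaussian (\<lambda>x::real^'d. 1 + (x $ i)\<^sup>2)"
    by (intro Bochner_Integration.integrable_add std_gaussian_coordinate_sq) simp
  then show "integrable std_gaussian (\<lambda>x::real^'d. x $ i)"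
    by (rule Bochner_Integration.integrable_bound) (measurable, intro AE_I2 bound)
  show "(\<integral>x. x $ i \<partial>(std_gaussian :: (real^'d) measure)) = 0"
    using integral_std_gaussian_reflect [of "\<lambda>x. x $ i" i]
    by (simp add: reflect_coordinate_def)
qed

lemma std_gaussian_quadratic:
  fixes Q :: "real^'d^'d"
  shows "integrable std_gaussian (\<lambda>x. x \<bullet> (Q *v x))"
    and "(\<integral>x. x \<bullet> (Q *v x) \<partial>std_gaussian) = trace Q"
proof -
  have *: "x \<bullet> (Q *v x) = (\<Sum>i\<in>UNIV. \<Sum>j\<in>UNIV. Q $ i $ j * (x $ i * x $ j))" for x :: "real^'d"
    by (simp add: inner_vec_def matrix_vector_mult_def sum_distrib_left algebra_simps)
  show "integrable std_gaussian (\<lambda>x. x \<bullet> (Q *v x))"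
    unfolding * by (intro Bochner_Integration.integrable_sum integrable_mult_right std_gaussian_coordinate_mult)
  show "(\<integral>x. x \<bullet> (Q *v x) \<partial>std_gaussian) = trace Q"
    unfolding *
    by (simp add: std_gaussian_coordinate_mult trace_def if_distrib cong: if_cong)
qed

lemma std_gaussian_linear:
  fixes b :: "real^'d"
  shows "integrable std_gaussian (\<lambda>x. b \<bullet> x)"
    and "(\<integral>x. b \<bullet> x \<partial>std_gaussian) = 0"
  unfolding inner_vec_def by (simp_all add: std_gaussian_coordinate)

section \<open>Gradients and vanishing integrals of derivatives\<close>

lemma has_derivative_grad:
  assumes "\<phi> differentiable (at x)"
  shows "(\<phi> has_derivative (\<lambda>v. grad \<phi> x \<bullet> v)) (at x)"
proof -
  let ?F = "frechet_derivative \<phi> (at x)"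
  have F: "(\<phi> has_derivative ?F) (at x)" using assms by (simp add: frechet_derivative_works)
  then have lin: "linear ?F" by (rule has_derivative_linear)
  have "?F v = grad \<phi> x \<bullet> v" for v
  proof -
    have "?F v = ?F (\<Sum>i\<in>UNIV. v $ i *\<^sub>R axis i 1)"
      using basis_expansion [of v] by (simp add: scalar_mult_eq_scaleR)
    also have "\<dots> = grad \<phi> x \<bullet> v"
      by (simp add: linear_sum [OF lin] linear_scale [OF lin] grad_def inner_vec_def mult.commute)
    finally show ?thesis .
  qed
  then have "?F = (\<lambda>v. grad \<phi> x \<bullet> v)" by blast
  with F show ?thesis by simp
qed

lemma grad_eqI:
  assumes "(\<phi> has_derivative (\<lambda>v. g \<bullet> v)) (at x)"
  shows "grad \<phi> x = g"
  using frechet_derivative_at [OF assms]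
  by (simp add: grad_def vec_eq_iff inner_axis flip: fun_eq_iff) (metis inner_axis inner_real_def mult.right_neutral)

lemma twice_cont_diffD:
  assumes "twice_cont_diff \<phi>"
  shows "(\<phi> has_derivative (\<lambda>v. grad \<phi> x \<bullet> v)) (at x)"
    and "((\<lambda>y. grad \<phi> y $ i) has_derivative (\<lambda>v. grad (\<lambda>y. grad \<phi> y $ i) x \<bullet> v)) (at x)"
    and "continuous_on UNIV (grad (\<lambda>y. grad \<phi> y $ i))"
    and "continuous_on UNIV \<phi>"
    and "continuous_on UNIV (grad \<phi>)"
proof -
  show 1: "(\<phi> has_derivative (\<lambda>v. grad \<phi> x \<bullet> v)) (at x)" for x
    using assms by (intro has_derivative_grad) (simp add: twice_cont_diff_def differentiable_on_def)
  show 2: "((\<lambda>y. grad \<phi> y $ i) has_derivative (\<lambda>v. grad (\<lambda>y. grad \<phi> y $ i) x \<bullet> v)) (at x)" for x i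
    using assms by (intro has_derivative_grad) (simp add: twice_cont_diff_def differentiable_on_def)
  show "continuous_on UNIV (grad (\<lambda>y. grad \<phi> y $ i))"
    using assms by (simp add: twice_cont_diff_def)
  show "continuous_on UNIV \<phi>"
    using has_derivative_continuous [OF 1] by (intro continuous_at_imp_continuous_on) auto
  have "continuous_on UNIV (\<lambda>x. grad \<phi> x $ i)" for i
    using has_derivative_continuous [OF 2] by (intro continuous_at_imp_continuous_on) auto
  then have "continuous_on UNIV (\<lambda>x. \<chi> i. grad \<phi> x $ i)"
    by (intro continuous_on_vec_lambda)
  then show "continuous_on UNIV (grad \<phi>)" by simp
qed

lemma has_real_derivative_along_axis:
  assumes "(\<phi> has_derivative (\<lambda>v. g \<bullet> v)) (at x)"
  shows "((\<lambda>t. \<phi> (x + t *\<^sub>R axis i 1)) has_real_derivative g $ i) (at 0)"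
proof -
  have "((\<lambda>t. x + t *\<^sub>R axis i 1) has_derivative (\<lambda>t. t *\<^sub>R axis i 1)) (at 0)"
    by (auto intro!: derivative_eq_intros)
  from diff_chain_at [OF this, of \<phi> "\<lambda>v. g \<bullet> v"] assms
  show ?thesis
    by (simp add: o_def has_field_derivative_def inner_axis mult_commute_abs)
qed

lemma integrable_lborel_compact_support:
  fixes F :: "'a::euclidean_space \<Rightarrow> real"
  assumes "continuous_on UNIV F" and supp: "\<And>x. r < norm x \<Longrightarrow> F x = 0"
  shows "integrable lborel F"
proof -
  have "integrable lborel (\<lambda>x. indicator (cball 0 r) x *\<^sub>R F x)"
    by (rule borel_integrable_compact) (auto intro: continuous_on_subset [OF assms(1)])
  also have "(\<lambda>x. indicator (cball 0 r) x *\<^sub>R F x) = F"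
    using supp by (auto simp: fun_eq_iff indicator_def not_le)
  finally show ?thesis .
qed

text \<open>The difference quotients of \<open>F\<close> have integral zero by translation invariance.\<close>

lemma integral_directional_derivative_eq_0:
  fixes F F' :: "'a::euclidean_space \<Rightarrow> real"
  assumes deriv: "\<And>x. ((\<lambda>t. F (x + t *\<^sub>R b)) has_real_derivative F' x) (at 0)"
    and cont: "continuous_on UNIV F" "continuous_on UNIV F'"
    and supp: "\<And>x. r < norm x \<Longrightarrow> F x = 0" "\<And>x. r < norm x \<Longrightarrow> F' x = 0"
  shows "(\<integral>x. F' x \<partial>lborel) = 0"
proof -
  have "bounded (F' ` cball 0 r)"
    by (intro compact_imp_bounded compact_continuous_image continuous_on_subset [OF cont(2)]) auto
  then obtain K where K: "\<forall>x\<in>cball 0 r. \<bar>F' x\<bar> \<le> K"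
    by (auto simp: bounded_iff)
  \<comment> \<open>The bound must be nonnegative to cover points outside the ball, where
    \<open>F'\<close> is 0; for an empty ball \<open>K\<close> could be negative.\<close>
  define B where "B = max K 0"
  have B: "\<bar>F' x\<bar> \<le> B" for x
    using K supp(2) [of x] by (cases "r < norm x") (auto simp: B_def le_max_iff_disj)
  have intF: "integrable lborel F"
    using cont(1) supp(1) by (rule integrable_lborel_compact_support)
  have [measurable]: "F \<in> borel_measurable borel" "F' \<in> borel_measurable borel"
    using cont by (auto intro: borel_measurable_continuous_onI)
  define q where "q n x = real (Suc n) * (F (x + (1 / real (Suc n)) *\<^sub>R b) - F x)" for n x
  \<comment> \<open>The quotient is a value of \<open>F'\<close> by the mean value theorem. The
    shift has length at most \<open>norm b\<close>, so the quotient vanishes outside the ball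
    enlarged by that amount. This gives one integrable majorant for all \<open>n\<close>.\<close>
  have qbound: "\<bar>q n x\<bar> \<le> B * indicator (cball 0 (r + norm b)) x" for n x
  proof (cases "norm x \<le> r + norm b")
    case True
    let ?t = "1 / real (Suc n)"
    have D: "((\<lambda>t. F (x + t *\<^sub>R b)) has_real_derivative F' (x + t *\<^sub>R b)) (at t)" for t
      using deriv [of "x + t *\<^sub>R b"] DERIV_shift [of "\<lambda>t. F (x + t *\<^sub>R b)" _ 0 t]
      by (simp add: algebra_simps)
    obtain z where "F (x + ?t *\<^sub>R b) - F (x + 0 *\<^sub>R b) = (?t - 0) * F' (x + z *\<^sub>R b)"
      using MVT2 [of 0 ?t "\<lambda>t. F (x + t *\<^sub>R b)" "\<lambda>t. F' (x + t *\<^sub>R b)"] D by auto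
    then have "q n x = F' (x + z *\<^sub>R b)" by (simp add: q_def del: of_nat_Suc)
    then show ?thesis using True B by simp
  next
    case False
    have "norm x \<le> norm (x + (1 / real (Suc n)) *\<^sub>R b) + norm ((1 / real (Suc n)) *\<^sub>R b)"
      by (metis norm_triangle_sub add.commute add_diff_cancel_left' norm_minus_commute)
    also have "norm ((1 / real (Suc n)) *\<^sub>R b) \<le> norm b"
      by (simp add: field_simps)
    finally have "r < norm (x + (1 / real (Suc n)) *\<^sub>R b)" using False by simp
    moreover have "r < norm x" using False norm_ge_zero [of b] by linarith
    ultimately show ?thesis using False supp(1) by (simp add: q_def)
  qed
  have q0: "(\<integral>x. q n x \<partial>lborel) = 0" for n
  proof -
    have "integrable (distr lborel borel ((+) c)) F" for c using intF by (simp add: lborel_distr_plus)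
    then have int: "integrable lborel (\<lambda>x. F (c + x))" for c
      by (subst (asm) integrable_distr_eq) auto
    have "(\<integral>x. F x \<partial>distr lborel borel ((+) c)) = (\<integral>x. F (c + x) \<partial>lborel)" for c
      by (subst integral_distr) auto
    then have eq: "(\<integral>x. F (c + x) \<partial>lborel) = (\<integral>x. F x \<partial>lborel)" for c
      by (simp add: lborel_distr_plus)
    show ?thesis
      unfolding q_def using int intF eq
      by (simp add: add.commute [of _ "_ *\<^sub>R b"])
  qed
  have qlim: "(\<lambda>n. q n x) \<longlonglongrightarrow> F' x" for x
  proof -
    have "((\<lambda>t. (F (x + t *\<^sub>R b) - F x) / t) \<longlongrightarrow> F' x) (at 0)"
      using deriv [of x] by (simp add: DERIV_def)
    moreover have "filterlim (\<lambda>n. 1 / real (Suc n)) (at 0) sequentially"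
      using LIMSEQ_inverse_real_of_nat by (simp add: filterlim_at inverse_eq_divide)
    ultimately have "(\<lambda>n. (F (x + (1 / real (Suc n)) *\<^sub>R b) - F x) / (1 / real (Suc n))) \<longlonglongrightarrow> F' x"
      by (rule filterlim_compose)
    then show ?thesis by (simp add: q_def [abs_def] mult.commute)
  qed
  have "(\<lambda>n. \<integral>x. q n x \<partial>lborel) \<longlonglongrightarrow> (\<integral>x. F' x \<partial>lborel)"
  proof (rule integral_dominated_convergence)
    show "integrable lborel (\<lambda>x. B * indicator (cball 0 (r + norm b)) x)"
      by (intro integrable_mult_right integrable_real_indicator) (auto intro: emeasure_bounded_finite [unfolded infinity_ennreal_def])
    show "q n \<in> borel_measurable lborel" for n
      unfolding q_def [abs_def] by measurable
  qed (use qlim qbound in auto)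
  then show ?thesis by (simp add: q0 LIMSEQ_const_iff)
qed

text \<open>The set where \<open>f\<close> is nonzero is open and negligible, hence empty.\<close>

lemma continuous_AE_eq_0:
  fixes f :: "'a::euclidean_space \<Rightarrow> real"
  assumes "continuous_on UNIV f" "AE x in lborel. f x = 0"
  shows "f x = 0"
proof -
  have op: "open {x. f x \<noteq> 0}"
    using open_Collect_neq [OF assms(1) continuous_on_const [of UNIV 0]] by simp
  have "{x. f x \<noteq> 0} \<in> null_sets lborel"
    using assms(2) op by (subst (asm) AE_iff_null) auto
  then have "negligible {x. f x \<noteq> 0}"
    by (simp add: negligible_iff_null_sets null_sets_completionI)
  with op show ?thesis using open_not_negligible by blast
qed

text \<open>
  Integrate the divergence of \<open>p(|x|\<^sup>2) g(h) \<nabla>h - k(|x|\<^sup>2) G(h) x - \<alpha> p(|x|\<^sup>2) G(h) J x\<close>,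
  where \<open>k = p + 2 p'\<close>. The last term is harmless because \<open>J x\<close> is divergence free and
  orthogonal to the gradient of every radial function.
\<close>

lemma radial_integration_by_parts:
  fixes J :: "real^'d^'d" and h :: "real^'d \<Rightarrow> real" and p p' k k' G g g' :: "real \<Rightarrow> real"
  assumes h: "twice_cont_diff h" and J: "transpose J = - J"
    and p: "\<And>t. (p has_real_derivative p' t) (at t)"
    and k: "\<And>t. (k has_real_derivative k' t) (at t)"
    and k_eq: "\<And>t. k t = p t + 2 * p' t" and k': "continuous_on UNIV k'"
    and supp: "\<And>t. R < t \<Longrightarrow> p t = 0" "\<And>t. R < t \<Longrightarrow> k t = 0" "\<And>t. R < t \<Longrightarrow> k' t = 0"
    and G: "\<And>y. (G has_real_derivative g y) (at y)"
    and g: "\<And>y. (g has_real_derivative g' y) (at y)" and g': "continuous_on UNIV g'"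
  shows "(\<integral>x. p (x \<bullet> x) * (g' (h x) * (norm (grad h x))\<^sup>2 + g (h x) * ou_generator J \<alpha> h x) \<partial>lborel)
    = (\<integral>x. G (h x) * (CARD('d) * k (x \<bullet> x) + 2 * (x \<bullet> x) * k' (x \<bullet> x)) \<partial>lborel)"
proof -
  define F where "F i x = p (x \<bullet> x) * g (h x) * grad h x $ i - k (x \<bullet> x) * x $ i * G (h x)
      - \<alpha> * (p (x \<bullet> x) * G (h x) * (J *v x) $ i)" for i x
  \<comment> \<open>This is the partial derivative of the component \<open>F i\<close> in direction
    \<open>i\<close>, so the sum over \<open>i\<close> is the divergence.\<close>
  define F' where "F' i x =
      2 * x $ i * p' (x \<bullet> x) * g (h x) * grad h x $ i
      + p (x \<bullet> x) * g' (h x) * (grad h x $ i)\<^sup>2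
      + p (x \<bullet> x) * g (h x) * grad (\<lambda>y. grad h y $ i) x $ i
      - (2 * (x $ i)\<^sup>2 * k' (x \<bullet> x) * G (h x) + k (x \<bullet> x) * G (h x)
          + k (x \<bullet> x) * x $ i * g (h x) * grad h x $ i)
      - \<alpha> * (2 * x $ i * p' (x \<bullet> x) * G (h x) * (J *v x) $ i
          + p (x \<bullet> x) * g (h x) * grad h x $ i * (J *v x) $ i)" for i x
  note hD = twice_cont_diffD [OF h]
  have contD: "continuous_on UNIV f" if "\<And>t. (f has_real_derivative f' t) (at t)" for f f' :: "real \<Rightarrow> real"
    using that by (meson DERIV_isCont continuous_at_imp_continuous_on)
  have cp: "continuous_on UNIV p" and ck: "continuous_on UNIV k"
    and cG: "continuous_on UNIV G" and cg: "continuous_on UNIV g"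
    using contD p k G g by blast+
  \<comment> \<open>Reading \<open>k_eq\<close> backwards lets \<open>p'\<close> inherit continuity
    and support from \<open>p\<close> and \<open>k\<close>.\<close>
  have p'_eq: "p' t = (k t - p t) / 2" for t by (simp add: k_eq)
  have cp': "continuous_on UNIV p'"
    unfolding p'_eq [abs_def] by (intro continuous_intros cp ck) auto
  have supp_p': "p' t = 0" if "R < t" for t using supp that by (simp add: p'_eq)
  have cgrad: "continuous_on UNIV (\<lambda>x. grad h x $ i)"
    and cgrad2: "continuous_on UNIV (\<lambda>x. grad (\<lambda>y. grad h y $ i) x $ i)" for i
    using hD(5) hD(3) [of i] by (auto intro: continuous_on_component)
  have cJ: "continuous_on UNIV (\<lambda>x. (J *v x) $ i)" for i
    by (intro continuous_intros matrix_vector_mult_linear_continuous_on)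
  have cr: "continuous_on UNIV (\<lambda>x. f (x \<bullet> x))" if "continuous_on UNIV f"
    for f :: "real \<Rightarrow> real" and x :: "real^'d"
    by (rule continuous_on_compose2 [OF that]) (auto intro!: continuous_intros)
  have ch: "continuous_on UNIV (\<lambda>x. f (h x))" if "continuous_on UNIV f" for f :: "real \<Rightarrow> real"
    by (rule continuous_on_compose2 [OF that]) (auto intro!: hD)
  note cont = cr [OF cp] cr [OF cp'] cr [OF ck] cr [OF k'] ch [OF cG] ch [OF cg] ch [OF g']
    cgrad cgrad2 cJ hD(5)
  have far: "R < x \<bullet> x" if "sqrt \<bar>R\<bar> < norm x" for x :: "real^'d"
    using that real_sqrt_less_iff [of "\<bar>R\<bar>" "x \<bullet> x"] by (simp add: norm_eq_sqrt_inner)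
  have deriv: "((\<lambda>t. F i (x + t *\<^sub>R axis i 1)) has_real_derivative F' i x) (at 0)" for i x
  proof -
    let ?y = "\<lambda>t. x + t *\<^sub>R axis i 1"
    have 1: "((\<lambda>t. ?y t \<bullet> ?y t) has_real_derivative 2 * x $ i) (at 0)"
      by (auto intro!: derivative_eq_intros simp: has_field_derivative_def inner_axis inner_commute)
    have 2: "((\<lambda>t. f (?y t \<bullet> ?y t)) has_real_derivative f' (x \<bullet> x) * (2 * x $ i)) (at 0)"
      if "\<And>t. (f has_real_derivative f' t) (at t)" for f f'
      using DERIV_chain2 [OF that 1] by simp
    have 3: "((\<lambda>t. h (?y t)) has_real_derivative grad h x $ i) (at 0)"
      by (rule has_real_derivative_along_axis [OF hD(1)])
    have 4: "((\<lambda>t. f (h (?y t))) has_real_derivative f' (h x) * grad h x $ i) (at 0)"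
      if "\<And>t. (f has_real_derivative f' t) (at t)" for f f'
      using DERIV_chain2 [OF that 3] by simp
    have 5: "((\<lambda>t. grad h (?y t) $ i) has_real_derivative grad (\<lambda>y. grad h y $ i) x $ i) (at 0)"
      by (rule has_real_derivative_along_axis [OF hD(2)])
    have 6: "((\<lambda>t. ?y t $ i) has_real_derivative 1) (at 0)"
      by (auto intro!: derivative_eq_intros)
    \<comment> \<open>The diagonal of \<open>J\<close> is zero, so component \<open>i\<close> of
      \<open>J x\<close> is constant along axis \<open>i\<close>; this is why the rotational field
      is divergence free.\<close>
    have 7: "((\<lambda>t. (J *v ?y t) $ i) has_real_derivative 0) (at 0)"
    proof -
      have "(J *v axis i 1) $ i = 0"
        using antisymmetric_diag [OF J, of i] by (simp add: matrix_vector_mult_basis column_def)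
      then have "(\<lambda>t. (J *v ?y t) $ i) = (\<lambda>t. (J *v x) $ i)"
        by (simp add: matrix_vector_right_distrib matrix_vector_mult_scaleR)
      then show ?thesis by simp
    qed
    show ?thesis
      unfolding F_def F'_def
      by (rule derivative_eq_intros 2 [OF p] 2 [OF k] 4 [OF G] 4 [OF g] 5 6 7 refl)+
        (simp add: algebra_simps power2_eq_square)
  qed
  have contF: "continuous_on UNIV (F i)" "continuous_on UNIV (F' i)" for i
    unfolding F_def [abs_def] F'_def [abs_def] by (intro continuous_intros cont)+
  have suppF: "F i x = 0" "F' i x = 0" if "sqrt \<bar>R\<bar> < norm x" for i x
    using far [OF that] by (simp_all add: F_def F'_def supp supp_p')
  let ?a = "\<lambda>x. p (x \<bullet> x) * (g' (h x) * (norm (grad h x))\<^sup>2 + g (h x) * ou_generator J \<alpha> h x)"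
  let ?b = "\<lambda>x. G (h x) * (CARD('d) * k (x \<bullet> x) + 2 * (x \<bullet> x) * k' (x \<bullet> x))"
  \<comment> \<open>The radial terms combine with coefficient \<open>2 p' - k = - p\<close>, which
    is exactly the symmetric part of the drift. Thus the second-order term, this part and the
    rotational term form \<open>p\<close> times \<open>g (h x)\<close> times the generator.\<close>
  have sum_eq: "(\<Sum>i\<in>UNIV. F' i x) = ?a x - ?b x" for x
  proof -
    have gen: "ou_generator J \<alpha> h x
        = (\<Sum>i\<in>UNIV. grad (\<lambda>y. grad h y $ i) x $ i) - x \<bullet> grad h x - \<alpha> * ((J *v x) \<bullet> grad h x)"
      by (simp add: ou_generator_def laplacian_def matrix_vector_mult_add_rdistrib inner_add_left
          scaleR_matrix_vector_assoc [symmetric])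
    have ng: "(norm (grad h x))\<^sup>2 = (\<Sum>i\<in>UNIV. (grad h x $ i)\<^sup>2)"
      unfolding power2_norm_eq_inner by (simp add: inner_vec_def power2_eq_square)
    have "(\<Sum>i\<in>UNIV. F' i x) =
        2 * p' (x \<bullet> x) * g (h x) * (x \<bullet> grad h x)
        + p (x \<bullet> x) * g' (h x) * (\<Sum>i\<in>UNIV. (grad h x $ i)\<^sup>2)
        + p (x \<bullet> x) * g (h x) * (\<Sum>i\<in>UNIV. grad (\<lambda>y. grad h y $ i) x $ i)
        - (2 * (x \<bullet> x) * k' (x \<bullet> x) * G (h x) + CARD('d) * k (x \<bullet> x) * G (h x)
          + k (x \<bullet> x) * g (h x) * (x \<bullet> grad h x))
        - \<alpha> * (2 * p' (x \<bullet> x) * G (h x) * (x \<bullet> (J *v x)) + p (x \<bullet> x) * g (h x) * ((J *v x) \<bullet> grad h x))"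
      unfolding F'_def
      by (simp add: sum.distrib sum_subtractf inner_vec_def power2_eq_square
          sum_distrib_left algebra_simps)
    also have "\<dots> = ?a x - ?b x"
      unfolding gen ng antisymmetric_quadratic_eq_0 [OF J] by (simp add: k_eq algebra_simps)
    finally show ?thesis .
  qed
  have int_b: "integrable lborel ?b"
  proof (rule integrable_lborel_compact_support [where r = "sqrt \<bar>R\<bar>"])
    show "continuous_on UNIV ?b" by (intro continuous_intros cont)
  qed (simp add: far supp)
  have intF': "integrable lborel (F' i)" for i
    by (rule integrable_lborel_compact_support [OF contF(2) suppF(2)])
  have "integrable lborel (\<lambda>x. (\<Sum>i\<in>UNIV. F' i x) + ?b x)"
    by (intro Bochner_Integration.integrable_add Bochner_Integration.integrable_sum intF' int_b)
  then have int_a: "integrable lborel ?a" unfolding sum_eq by simp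
  have "0 = (\<Sum>i\<in>UNIV. \<integral>x. F' i x \<partial>lborel)"
    using integral_directional_derivative_eq_0 [OF deriv contF suppF] by simp
  also have "\<dots> = (\<integral>x. ?a x - ?b x \<partial>lborel)"
    by (simp only: Bochner_Integration.integral_sum [OF intF', symmetric] sum_eq)
  also have "\<dots> = (\<integral>x. ?a x \<partial>lborel) - (\<integral>x. ?b x \<partial>lborel)"
    by (rule Bochner_Integration.integral_diff [OF int_a int_b])
  finally show ?thesis by simp
qed

text \<open>Only the origin is delicate: there the difference quotient is itself
  \<open>max 0 h ^ Suc n\<close>, which tends to 0. This allows a polynomial cutoff in place of a
  smooth bump function.\<close>

lemma DERIV_max_0_power:
  "((\<lambda>y. max 0 y ^ Suc (Suc n)) has_real_derivative real (Suc (Suc n)) * max 0 y ^ Suc n) (at y)"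
proof -
  consider "y < 0" | "y = 0" | "0 < y" by linarith
  then show ?thesis
  proof cases
    case 1
    have "((\<lambda>y. 0 :: real) has_real_derivative 0) (at y)" by simp
    then have "((\<lambda>y. max 0 y ^ Suc (Suc n)) has_real_derivative 0) (at y)"
      by (rule has_field_derivative_transform_within_open [of _ _ _ "{..<0}"]) (use 1 in \<open>auto simp: max_def\<close>)
    then show ?thesis using 1 by (simp add: max_def)
  next
    case 2
    have "isCont (\<lambda>h::real. max 0 h ^ Suc n) 0" by (intro continuous_intros)
    then have "((\<lambda>h::real. max 0 h ^ Suc n) \<longlongrightarrow> 0) (at 0)"
      by (simp add: isCont_def)
    moreover have "\<forall>\<^sub>F h in at (0::real). max 0 h ^ Suc n = (max 0 (0 + h) ^ Suc (Suc n) - max 0 0 ^ Suc (Suc n)) / h"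
      by (rule eventually_at_topological [THEN iffD2]) (auto simp: max_def intro!: exI [of _ UNIV])
    ultimately have "((\<lambda>h::real. (max 0 (0 + h) ^ Suc (Suc n) - max 0 0 ^ Suc (Suc n)) / h) \<longlongrightarrow> 0) (at 0)"
      by (rule Lim_transform_eventually)
    then show ?thesis using 2 by (simp add: DERIV_def)
  next
    case 3
    have "((\<lambda>y. y ^ Suc (Suc n)) has_real_derivative real (Suc (Suc n)) * y ^ Suc n) (at y)"
      by (auto intro!: derivative_eq_intros simp del: power_Suc)
    then have "((\<lambda>y. max 0 y ^ Suc (Suc n)) has_real_derivative real (Suc (Suc n)) * y ^ Suc n) (at y)"
      by (rule has_field_derivative_transform_within_open [of _ _ _ "{0<..}"]) (use 3 in \<open>auto simp: max_def\<close>)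
    then show ?thesis using 3 by (simp add: max_def)
  qed
qed

section \<open>Integrable harmonic functions are constant\<close>

lemma incseq_tendsto_0_imp_eq_0:
  fixes a :: "nat \<Rightarrow> real"
  assumes "a \<longlonglongrightarrow> 0" "incseq a" "\<And>n. 0 \<le> a n"
  shows "a n = 0"
  using incseq_le [OF assms(2,1), of n] assms(3) [of n] by simp

text \<open>
  Test \<open>L (sqrt (1 + h\<^sup>2)) = (1 + h\<^sup>2) powr (- 3 / 2) * |\<nabla>h|\<^sup>2\<close> against the Gaussian times
  the cutoff \<open>max 0 (1 - \<epsilon> |x|\<^sup>2) ^ 3\<close>. The function \<open>sqrt (1 + h\<^sup>2)\<close> grows at most
  linearly in \<open>h\<close>, so that integrability of \<open>h\<close> lets \<open>\<epsilon>\<close> tend to zero.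
\<close>

lemma ou_harmonic_integrable_imp_constant:
  fixes J :: "real^'d^'d" and h :: "real^'d \<Rightarrow> real"
  assumes J: "transpose J = - J" and h: "twice_cont_diff h"
    and harm: "\<And>x. ou_generator J \<alpha> h x = 0" and int: "integrable std_gaussian h"
  shows "\<exists>c. \<forall>x. h x = c"
proof -
  define e where "e n = 1 / real (Suc n)" for n
  define q where "q n t = max 0 (1 - e n * t)" for n and t :: real
  \<comment> \<open>The argument \<open>t\<close> stands for the squared norm of \<open>x\<close>.
    The Gaussian factor alone satisfies \<open>p + 2 p' = 0\<close>, so only derivatives of the
    cutoff survive in \<open>k\<close>, each with a factor \<open>e n\<close>. The exponent 3 keeps
    the second derivative of \<open>p n\<close>, and with it \<open>k' n\<close>,
    continuous.\<close>
  define p where "p n t = exp (- t / 2) * q n t ^ 3" for n t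
  define p' where "p' n t = exp (- t / 2) * (- 3 * e n * q n t ^ 2 - q n t ^ 3 / 2)" for n t
  define k where "k n t = exp (- t / 2) * (- 6 * e n * q n t ^ 2)" for n t
  define k' where "k' n t = exp (- t / 2) * (3 * e n * q n t ^ 2 + 12 * (e n)\<^sup>2 * q n t)" for n t
  define G where "G y = sqrt (1 + y\<^sup>2)" for y :: real
  define g where "g y = y / G y" for y
  define g' where "g' y = 1 / G y ^ 3" for y
  have e: "0 < e n" "e n \<le> 1" for n by (simp_all add: e_def)
  have elim: "e \<longlonglongrightarrow> 0"
    using LIMSEQ_inverse_real_of_nat by (simp add: e_def [abs_def] inverse_eq_divide)
  have q: "0 \<le> q n t" and q1: "0 \<le> t \<Longrightarrow> q n t \<le> 1" for n t
    using e [of n] by (auto simp: q_def)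
  have qpow: "((\<lambda>t. q n t ^ Suc (Suc m)) has_real_derivative
      - (real (Suc (Suc m)) * e n * q n t ^ Suc m)) (at t)" for n m t
  proof -
    have "((\<lambda>t. 1 - e n * t) has_real_derivative - e n) (at t)"
      by (auto intro!: derivative_eq_intros)
    from DERIV_chain2 [where g = "\<lambda>t. 1 - e n * t", OF DERIV_max_0_power [of m "1 - e n * t"] this]
    show ?thesis unfolding q_def by (simp add: mult_ac)
  qed
  have q3: "((\<lambda>t. q n t ^ 3) has_real_derivative - (3 * e n * q n t ^ 2)) (at t)"
    and q2: "((\<lambda>t. q n t ^ 2) has_real_derivative - (2 * e n * q n t)) (at t)" for n t
    using qpow [of n 1 t] qpow [of n 0 t] by (simp_all add: eval_nat_numeral)
  have p: "(p n has_real_derivative p' n t) (at t)" for n t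
    unfolding p_def [abs_def] p'_def by (rule derivative_eq_intros q3 refl | simp add: algebra_simps)+
  have k: "(k n has_real_derivative k' n t) (at t)" for n t
    unfolding k_def [abs_def] k'_def
    by (rule derivative_eq_intros q2 refl | simp add: algebra_simps power2_eq_square)+
  have k_eq: "k n t = p n t + 2 * p' n t" for n t
    by (simp add: k_def p_def p'_def algebra_simps)
  have cq: "continuous_on UNIV (q n)" for n
    unfolding q_def [abs_def] by (intro continuous_intros)
  have k'_cont: "continuous_on UNIV (k' n)" for n
    unfolding k'_def [abs_def] by (intro continuous_intros cq) auto
  have supp: "p n t = 0" "k n t = 0" "k' n t = 0" if "1 / e n < t" for n t
  proof -
    have "q n t = 0" using that e [of n] by (simp add: q_def field_simps)
    then show "p n t = 0" "k n t = 0" "k' n t = 0" by (simp_all add: p_def k_def k'_def)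
  qed
  have G1: "1 \<le> G y" for y by (simp add: G_def)
  then have G0: "0 < G y" "G y \<noteq> 0" for y
    by (meson less_le_trans zero_less_one, metis not_one_le_zero)
  have Gsq: "G y ^ 2 = 1 + y\<^sup>2" for y by (simp add: G_def)
  have G: "(G has_real_derivative g y) (at y)" for y
  proof -
    have "0 < 1 + y\<^sup>2" by (simp add: add_pos_nonneg)
    moreover have "((\<lambda>y. 1 + y\<^sup>2) has_real_derivative 2 * y) (at y)"
      by (auto intro!: derivative_eq_intros)
    ultimately have "(G has_real_derivative inverse (sqrt (1 + y\<^sup>2)) / 2 * (2 * y)) (at y)"
      unfolding G_def [abs_def] by (intro DERIV_chain2 [where f = sqrt] DERIV_real_sqrt)
    then show ?thesis by (simp add: g_def G_def field_simps)
  qed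
  have g: "(g has_real_derivative g' y) (at y)" for y
  proof -
    have "(g has_real_derivative (1 * G y - y * g y) / (G y * G y)) (at y)"
      unfolding g_def [abs_def] using G0 G [of y]
      by (intro DERIV_divide DERIV_ident) (auto simp: g_def)
    moreover have "(1 * G y - y * g y) / (G y * G y) = g' y"
    proof -
      have "G y * G y = 1 + y * y" using Gsq [of y] by (simp add: power2_eq_square)
      then have "1 * G y - y * g y = 1 / G y" using G0 [of y] by (simp add: g_def field_simps)
      then show ?thesis by (simp add: g'_def power3_eq_cube)
    qed
    ultimately show ?thesis by simp
  qed
  have cG: "continuous_on UNIV G" unfolding G_def [abs_def] by (intro continuous_intros)
  then have cg': "continuous_on UNIV g'"
    unfolding g'_def [abs_def] using G0 by (intro continuous_intros) auto
  let ?Q = "\<lambda>x. g' (h x) * (norm (grad h x))\<^sup>2"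
  let ?b = "\<lambda>n x. G (h x) * (CARD('d) * k n (x \<bullet> x) + 2 * (x \<bullet> x) * k' n (x \<bullet> x))"
  have parts: "(\<integral>x. p n (x \<bullet> x) * ?Q x \<partial>lborel) = (\<integral>x. ?b n x \<partial>lborel)" for n
    using radial_integration_by_parts [where R = "1 / e n" and \<alpha> = \<alpha>,
        OF h J p [of n] k [of n] k_eq [of n] k'_cont [of n] supp [of n] G g cg']
    by (simp add: harm)
  note hD = twice_cont_diffD [OF h]
  have contQ: "continuous_on UNIV ?Q"
    by (intro continuous_intros hD continuous_on_compose2 [OF cg' hD(4)]) auto
  have contp: "continuous_on UNIV (\<lambda>x::real^'d. p n (x \<bullet> x))" for n
    unfolding p_def [abs_def]
    by (intro continuous_intros continuous_on_compose2 [OF cq [of n]]) auto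
  have Q: "0 \<le> ?Q x" for x using G0 [of "h x"] by (simp add: g'_def less_imp_le)
  have intpQ: "integrable lborel (\<lambda>x. p n (x \<bullet> x) * ?Q x)" for n
  proof (rule integrable_lborel_compact_support)
    show "continuous_on UNIV (\<lambda>x. p n (x \<bullet> x) * ?Q x)"
      by (intro continuous_on_mult contp contQ)
    show "p n (x \<bullet> x) * ?Q x = 0" if "sqrt (1 / e n) < norm x" for x
    proof -
      have "1 / e n < x \<bullet> x" using that by (simp add: norm_eq_sqrt_inner)
      then show ?thesis by (simp add: supp)
    qed
  qed
  have hmeas [measurable]: "h \<in> borel_measurable borel"
    using hD(4) by (rule borel_measurable_continuous_onI)
  \<comment> \<open>Every term of \<open>?b n\<close> carries a factor \<open>e n\<close>, which
    gives the pointwise limit 0. Integrability of \<open>h\<close> enters through the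
    majorant.\<close>
  have "(\<lambda>n. \<integral>x. ?b n x \<partial>lborel) \<longlonglongrightarrow> (\<integral>x. 0 \<partial>(lborel :: (real^'d) measure))"
  proof (rule integral_dominated_convergence)
    let ?c = "(1 / sqrt (2 * pi)) ^ CARD('d)"
    \<comment> \<open>Dividing by \<open>?c\<close> leaves the bare exponential of the Gaussian
      density. The contribution of \<open>k n\<close> is bounded by \<open>6 * CARD('d)\<close>, and
      that of \<open>2 * t * k' n\<close> by 6 + 24 = 30.\<close>
    let ?w = "\<lambda>x. (6 * CARD('d) + 30) / ?c * (gaussian_density x * (1 + \<bar>h x\<bar>))"
    have "integrable std_gaussian (\<lambda>x. 1 + \<bar>h x\<bar>)"
      using int prob_space.finite_measure [OF prob_space_std_gaussian]
      by (intro Bochner_Integration.integrable_add integrable_abs finite_measure.integrable_const)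
    then show "integrable lborel ?w"
      by (intro integrable_mult_right) (simp add: integrable_std_gaussian_iff)
    show "?b n \<in> borel_measurable lborel" for n
      unfolding k_def k'_def q_def G_def by measurable
    show "AE x in lborel. (\<lambda>n. ?b n x) \<longlonglongrightarrow> 0"
    proof (rule AE_I2)
      fix x :: "real^'d"
      have "(\<lambda>n. ?b n x) \<longlonglongrightarrow> G (h x) * (CARD('d) * (exp (- (x \<bullet> x) / 2) * (- 6 * 0 * (max 0 (1 - 0 * (x \<bullet> x)))\<^sup>2))
        + 2 * (x \<bullet> x) * (exp (- (x \<bullet> x) / 2) * (3 * 0 * (max 0 (1 - 0 * (x \<bullet> x)))\<^sup>2
          + 12 * 0\<^sup>2 * max 0 (1 - 0 * (x \<bullet> x)))))"
        unfolding k_def k'_def q_def by (intro tendsto_intros elim)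
      then show "(\<lambda>n. ?b n x) \<longlonglongrightarrow> 0" by simp
    qed
    show "AE x in lborel. norm (?b n x) \<le> ?w x" for n
    proof (rule AE_I2)
      fix x :: "real^'d"
      define t where "t = x \<bullet> x"
      have t: "0 \<le> t" by (simp add: t_def)
      define u where "u = q n t"
      have u: "0 \<le> u" "u \<le> 1" using q q1 [OF t] by (simp_all add: u_def)
      \<comment> \<open>Where the cutoff is nonzero, \<open>e n * t\<close> is at most 1; this
        absorbs the factor \<open>x \<bullet> x\<close> that would otherwise spoil the
        majorant.\<close>
      have etu: "0 \<le> e n * t * u" "e n * t * u \<le> 1"
      proof -
        show "0 \<le> e n * t * u" using e [of n] t u by simp
        have "e n * t \<le> 1 \<or> u = 0" by (auto simp: u_def q_def)
        moreover have "0 \<le> e n * t" using e [of n] t by simp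
        ultimately show "e n * t * u \<le> 1" using u by (auto intro: mult_le_one)
      qed
      have b1: "e n * u ^ 2 \<le> 1" "0 \<le> e n * u ^ 2"
        using e [of n] u by (auto intro!: mult_le_one power_le_one)
      have b2: "e n * t * u * u \<le> 1" "0 \<le> e n * t * u * u"
        using etu u by (auto intro!: mult_le_one)
      have b3: "e n * (e n * t * u) \<le> 1" "0 \<le> e n * (e n * t * u)"
        using e [of n] etu by (auto intro!: mult_le_one)
      have "CARD('d) * k n t + 2 * t * k' n t
          = exp (- t / 2) * (- (6 * CARD('d)) * (e n * u ^ 2) + 6 * (e n * t * u * u) + 24 * (e n * (e n * t * u)))"
        by (simp add: k_def k'_def u_def algebra_simps power2_eq_square)
      moreover have "\<bar>- (6 * CARD('d)) * (e n * u ^ 2) + 6 * (e n * t * u * u) + 24 * (e n * (e n * t * u))\<bar>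
          \<le> 6 * CARD('d) + 30"
      proof -
        have "6 * real CARD('d) * (e n * u ^ 2) \<le> 6 * CARD('d)" "0 \<le> 6 * real CARD('d) * (e n * u ^ 2)"
          using b1 by (auto intro!: mult_left_le)
        then show ?thesis using b2 b3 by (simp only: abs_le_iff) linarith
      qed
      ultimately have "\<bar>CARD('d) * k n t + 2 * t * k' n t\<bar> \<le> exp (- t / 2) * (6 * CARD('d) + 30)"
        by (simp add: abs_mult)
      moreover have "\<bar>G (h x)\<bar> \<le> 1 + \<bar>h x\<bar>"
        using sqrt_sum_squares_le_sum_abs [of 1 "h x"] by (simp add: G_def)
      ultimately have "norm (?b n x) \<le> (1 + \<bar>h x\<bar>) * (exp (- t / 2) * (6 * CARD('d) + 30))"
        unfolding real_norm_def abs_mult t_def [symmetric] by (intro mult_mono) auto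
      also have "\<dots> = ?w x"
        by (simp add: gaussian_density_eq t_def)
      finally show "norm (?b n x) \<le> ?w x" .
    qed
  qed auto
  then have lim: "(\<lambda>n. \<integral>x. p n (x \<bullet> x) * ?Q x \<partial>lborel) \<longlonglongrightarrow> 0"
    by (simp add: parts)
  have pos: "0 \<le> p n t" for n t using q by (simp add: p_def)
  \<comment> \<open>The cutoffs increase with \<open>n\<close> and \<open>?Q\<close> is nonnegative,
    so the integrals form an increasing nonnegative sequence with limit 0. Each of them is therefore
    already 0.\<close>
  have mono: "p m t \<le> p n t" if "m \<le> n" "0 \<le> t" for m n t
  proof -
    have "e n \<le> e m" using that by (simp add: e_def frac_le)
    then have "e n * t \<le> e m * t" using that by (intro mult_right_mono)
    then have "q m t \<le> q n t" by (auto simp: q_def)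
    then show ?thesis unfolding p_def using q by (intro mult_left_mono power_mono) auto
  qed
  have zero: "(\<integral>x. p n (x \<bullet> x) * ?Q x \<partial>lborel) = 0" for n
  proof (rule incseq_tendsto_0_imp_eq_0 [OF lim])
    show "incseq (\<lambda>n. \<integral>x. p n (x \<bullet> x) * ?Q x \<partial>lborel)"
      unfolding incseq_def
      by (intro allI impI integral_mono intpQ mult_right_mono mono Q) auto
    show "0 \<le> (\<integral>x. p n (x \<bullet> x) * ?Q x \<partial>lborel)" for n
      by (intro Bochner_Integration.integral_nonneg mult_nonneg_nonneg pos Q)
  qed
  have "grad h x = 0" for x
  proof -
    \<comment> \<open>Since \<open>1 / e n = Suc n\<close>, this choice puts \<open>x\<close>
      strictly inside the support of the cutoff, where \<open>p n\<close> is positive and can be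
      cancelled.\<close>
    obtain n where n: "x \<bullet> x < real (Suc n)"
      using reals_Archimedean2 [of "x \<bullet> x"] by (meson less_trans of_nat_less_iff lessI)
    have "AE x in lborel. p n (x \<bullet> x) * ?Q x = 0"
      using integral_nonneg_eq_0_iff_AE [OF intpQ, of n] zero [of n] pos Q by simp
    from continuous_AE_eq_0 [OF continuous_on_mult [OF contp contQ] this]
    have "p n (x \<bullet> x) * ?Q x = 0" .
    moreover have "p n (x \<bullet> x) \<noteq> 0"
      using n by (simp add: p_def q_def e_def max_def field_simps)
    ultimately show ?thesis using G0 [of "h x"] by (simp add: g'_def)
  qed
  then have "(h has_derivative (\<lambda>v. 0)) (at x)" for x
    using hD(1) [of x] by simp
  then show ?thesis using has_derivative_zero_constant [of UNIV h] by auto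
qed

section \<open>The Poisson equation and the asymptotic variance\<close>

declare transpose_matrix_vector [simp del]

section \<open>Calculus of quadratic polynomials\<close>

lemma transpose_inner: "(transpose A *v x) \<bullet> y = x \<bullet> (A *v y)" for A :: "real^'d^'d"
  by (metis dot_lmul_matrix transpose_matrix_vector)

text \<open>Symmetry of \<open>Q\<close> merges the two terms of the product rule into the single
  gradient \<open>2 Q x\<close>.\<close>

lemma has_derivative_quadratic:
  fixes Q :: "real^'d^'d"
  assumes "transpose Q = Q"
  shows "((\<lambda>x. x \<bullet> (Q *v x) + b \<bullet> x + c) has_derivative (\<lambda>v. (2 *\<^sub>R (Q *v x) + b) \<bullet> v)) (at x)"
proof -
  have Q: "((\<lambda>x. Q *v x) has_derivative (\<lambda>v. Q *v v)) (at x)"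
    by (rule bounded_linear_imp_has_derivative [OF matrix_vector_mul_bounded_linear])
  have "x \<bullet> (Q *v v) = (Q *v x) \<bullet> v" for v
    using transpose_inner [of Q x v] assms by simp
  then show ?thesis
    by (auto intro!: derivative_eq_intros Q simp: fun_eq_iff algebra_simps inner_commute)
qed

context
  fixes Q :: "real^'d^'d" and b :: "real^'d" and c :: real
  assumes Q: "transpose Q = Q"
begin

lemma grad_quadratic: "grad (\<lambda>x. x \<bullet> (Q *v x) + b \<bullet> x + c) x = 2 *\<^sub>R (Q *v x) + b"
  by (rule grad_eqI [OF has_derivative_quadratic [OF Q]])

lemma has_derivative_grad_quadratic:
  "((\<lambda>y. grad (\<lambda>x. x \<bullet> (Q *v x) + b \<bullet> x + c) y $ i) has_derivative (\<lambda>v. (2 *\<^sub>R Q $ i) \<bullet> v)) (at x)"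
  unfolding grad_quadratic
  by (auto intro!: derivative_eq_intros simp: matrix_mult_dot fun_eq_iff)

lemma twice_cont_diff_quadratic: "twice_cont_diff (\<lambda>x. x \<bullet> (Q *v x) + b \<bullet> x + c)"
  unfolding twice_cont_diff_def
proof (intro conjI allI)
  show "(\<lambda>x. x \<bullet> (Q *v x) + b \<bullet> x + c) differentiable_on UNIV"
    using has_derivative_quadratic [OF Q] by (auto simp: differentiable_on_def differentiable_def)
  show "(\<lambda>y. grad (\<lambda>x. x \<bullet> (Q *v x) + b \<bullet> x + c) y $ i) differentiable_on UNIV" for i
    using has_derivative_grad_quadratic by (auto simp: differentiable_on_def differentiable_def)
  show "continuous_on UNIV (grad (\<lambda>y. grad (\<lambda>x. x \<bullet> (Q *v x) + b \<bullet> x + c) y $ i))" for i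
    using grad_eqI [OF has_derivative_grad_quadratic] by simp
qed

lemma laplacian_quadratic: "laplacian (\<lambda>x. x \<bullet> (Q *v x) + b \<bullet> x + c) x = 2 * trace Q"
  unfolding laplacian_def grad_eqI [OF has_derivative_grad_quadratic]
  by (simp add: trace_def sum_distrib_left)

end

section \<open>Differences of solutions and uniqueness\<close>

lemma grad_diff:
  assumes "\<phi> differentiable (at x)" "\<psi> differentiable (at x)"
  shows "grad (\<lambda>x. \<phi> x - \<psi> x) x = grad \<phi> x - grad \<psi> x"
  using has_derivative_diff [OF has_derivative_grad [OF assms(1)] has_derivative_grad [OF assms(2)]]
  by (intro grad_eqI) (simp add: inner_diff_left)

lemma twice_cont_diff_differentiable:
  assumes "twice_cont_diff \<phi>"
  shows "\<phi> differentiable (at x)" "(\<lambda>y. grad \<phi> y $ i) differentiable (at x)"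
  using assms by (simp_all add: twice_cont_diff_def differentiable_on_def)

context
  fixes \<phi> \<psi> :: "real^'d \<Rightarrow> real"
  assumes \<phi>: "twice_cont_diff \<phi>" and \<psi>: "twice_cont_diff \<psi>"
begin

lemma grad_diff_twice_cont_diff: "grad (\<lambda>x. \<phi> x - \<psi> x) x = grad \<phi> x - grad \<psi> x"
  using \<phi> \<psi> by (intro grad_diff twice_cont_diff_differentiable)

lemma grad_grad_diff:
  "grad (\<lambda>y. grad (\<lambda>x. \<phi> x - \<psi> x) y $ i) x
    = grad (\<lambda>y. grad \<phi> y $ i) x - grad (\<lambda>y. grad \<psi> y $ i) x"
  using \<phi> \<psi> by (simp add: grad_diff_twice_cont_diff grad_diff twice_cont_diff_differentiable)

lemma twice_cont_diff_diff: "twice_cont_diff (\<lambda>x. \<phi> x - \<psi> x)"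
  unfolding twice_cont_diff_def
proof (intro conjI allI)
  note D = \<phi> [unfolded twice_cont_diff_def] \<psi> [unfolded twice_cont_diff_def]
  show "(\<lambda>x. \<phi> x - \<psi> x) differentiable_on UNIV"
    using D by (intro differentiable_on_diff) auto
  show "(\<lambda>y. grad (\<lambda>x. \<phi> x - \<psi> x) y $ i) differentiable_on UNIV" for i
    unfolding grad_diff_twice_cont_diff vector_minus_component using D by (intro differentiable_on_diff) auto
  show "continuous_on UNIV (grad (\<lambda>y. grad (\<lambda>x. \<phi> x - \<psi> x) y $ i))" for i
    unfolding grad_grad_diff [abs_def] using D by (intro continuous_on_diff) auto
qed

lemma ou_generator_diff:
  "ou_generator J \<alpha> (\<lambda>x. \<phi> x - \<psi> x) x = ou_generator J \<alpha> \<phi> x - ou_generator J \<alpha> \<psi> x"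
  unfolding ou_generator_def laplacian_def grad_grad_diff vector_minus_component sum_subtractf
  unfolding grad_diff_twice_cont_diff by (simp add: inner_diff_right)

end

text \<open>The difference of two solutions is integrable and annihilated by the generator, hence
  constant. Under a probability measure its mean is that constant, so it is zero.\<close>

lemma mean_zero_poisson_solution_unique:
  fixes J :: "real^'d^'d"
  assumes J: "transpose J = - J"
    and \<phi>: "mean_zero_poisson_solution J \<alpha> f \<phi>" and \<psi>: "mean_zero_poisson_solution J \<alpha> f \<psi>"
  shows "\<phi> = \<psi>"
proof -
  note sol = \<phi> [unfolded mean_zero_poisson_solution_def] \<psi> [unfolded mean_zero_poisson_solution_def]
  let ?h = "\<lambda>x. \<phi> x - \<psi> x"
  have int: "integrable std_gaussian \<phi>" "integrable std_gaussian \<psi>" using sol by auto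
  have "ou_generator J \<alpha> ?h x = 0" for x
    using sol by (simp add: ou_generator_diff) (metis neg_equal_iff_equal)
  then have "\<exists>c. \<forall>x. ?h x = c"
    using sol
    by (intro ou_harmonic_integrable_imp_constant [OF J, of ?h \<alpha>] twice_cont_diff_diff
        Bochner_Integration.integrable_diff) auto
  then obtain c where c: "\<And>x. ?h x = c" by blast
  have "(\<integral>x. ?h x \<partial>std_gaussian) = 0"
    using sol by (subst Bochner_Integration.integral_diff [OF int]) auto
  then have "c = 0" unfolding c by (simp add: prob_space.prob_space [OF prob_space_std_gaussian, simplified])
  with c show ?thesis by auto
qed

text \<open>The quadratic form of the matrix is \<open>x \<bullet> x\<close>, because the
  antisymmetric part drops out, so the kernel is trivial.\<close>

lemma invertible_drift:
  fixes J :: "real^'d^'d"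
  assumes J: "transpose J = - J"
  shows "invertible (mat 1 - \<alpha> *\<^sub>R J)"
proof -
  have "x = 0" if "(mat 1 - \<alpha> *\<^sub>R J) *v x = 0" for x
  proof -
    have "x \<bullet> ((mat 1 - \<alpha> *\<^sub>R J) *v x) = x \<bullet> x"
      using antisymmetric_quadratic_eq_0 [OF J, of x]
      by (simp add: matrix_vector_mult_diff_rdistrib inner_diff_right scaleR_matrix_vector_assoc [symmetric])
    with that show ?thesis by simp
  qed
  then show ?thesis
    by (metis invertible_left_inverse matrix_left_invertible_ker)
qed

lemma matrix_inv_mult_vec: "invertible A \<Longrightarrow> A *v (matrix_inv A *v x) = x" for A :: "real^'d^'d"
proof -
  assume "invertible A"
  then have "A ** matrix_inv A = mat 1"
    unfolding invertible_def matrix_inv_def by (rule someI2_ex) simp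
  then show ?thesis by (simp add: matrix_vector_mul_assoc)
qed

section \<open>The explicit solution and its variance\<close>

context
  fixes J M A C :: "real^'d^'d" and l D :: "real^'d" and \<alpha> :: real and f :: "real^'d \<Rightarrow> real"
  assumes J: "transpose J = - J" and M_sym: "transpose M = M"
    and f: "f = (\<lambda>x. x \<bullet> (M *v x) + l \<bullet> x - trace M)"
    and A: "A = transpose (mat 1 + \<alpha> *\<^sub>R J)"
    and C: "C = (LINT s:{0..}|lborel.
                   mat_exp (- s *\<^sub>R A) ** M ** mat_exp (- s *\<^sub>R transpose A))"
    and D: "D = matrix_inv A *v l"
begin

lemma C_symmetric: "transpose C = C"
  unfolding C by (rule transpose_lyapunov [OF J A M_sym])

lemma C_equation: "A ** C + C ** transpose A = M"
  unfolding C by (rule lyapunov_equation [OF J A])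

lemma A_eq: "A = mat 1 - \<alpha> *\<^sub>R J" and transpose_A: "transpose A = mat 1 + \<alpha> *\<^sub>R J"
  using drift_transpose [OF J A] .

lemma A_mult_D: "A *v D = l"
  unfolding D using invertible_drift [OF J, of \<alpha>] by (simp add: A_eq matrix_inv_mult_vec)

lemma poisson_solution_quadratic:
  "mean_zero_poisson_solution J \<alpha> f (\<lambda>x. x \<bullet> (C *v x) + D \<bullet> x - trace C)"
proof -
  interpret prob_space "std_gaussian :: (real^'d) measure" by (rule prob_space_std_gaussian)
  have eq: "(\<lambda>x. x \<bullet> (C *v x) + D \<bullet> x - trace C) = (\<lambda>x. x \<bullet> (C *v x) + D \<bullet> x + - trace C)"
    by simp
  \<comment> \<open>Taking the trace of the Lyapunov equation, where \<open>A + A^T\<close> is twice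
    the identity, makes the Laplacian of the ansatz match the constant \<open>- trace M\<close> in
    \<open>f\<close>.\<close>
  have "trace M = 2 * trace C"
  proof -
    have "trace M = trace (A ** C) + trace (C ** transpose A)"
      unfolding C_equation [symmetric] by (rule trace_add)
    also have "\<dots> = trace ((A + transpose A) ** C)"
      by (simp add: matrix_mult_simps trace_add trace_mul_sym [of C "transpose A"])
    also have "A + transpose A = 2 *\<^sub>R mat 1"
      unfolding A_eq transpose_A by (subst transpose_A [unfolded A_eq]) (simp add: scaleR_2)
    also have "trace (2 *\<^sub>R mat 1 ** C) = 2 * trace C"
      by (simp add: matrix_mult_simps trace_def sum_distrib_left)
    finally show ?thesis .
  qed
  \<comment> \<open>The two summands of the Lyapunov equation have the same quadratic form since
    \<open>C\<close> is symmetric; this accounts for the factor 2 in the gradient.\<close>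
  moreover have "(transpose A *v x) \<bullet> (2 *\<^sub>R (C *v x) + D) = x \<bullet> (M *v x) + l \<bullet> x" for x
  proof -
    have "x \<bullet> (M *v x) = x \<bullet> (A *v (C *v x)) + x \<bullet> (C *v (transpose A *v x))"
      unfolding C_equation [symmetric]
      by (simp add: matrix_vector_mult_add_rdistrib inner_add_right matrix_vector_mul_assoc)
    also have "x \<bullet> (C *v (transpose A *v x)) = (C *v x) \<bullet> (transpose A *v x)"
      using transpose_inner [of C x "transpose A *v x"] by (simp add: C_symmetric)
    also have "\<dots> = x \<bullet> (A *v (C *v x))"
      by (simp add: inner_commute [of "C *v x"] transpose_inner)
    finally show ?thesis
      by (simp add: inner_add_right transpose_inner A_mult_D inner_commute [of l])
  qed
  ultimately have "- ou_generator J \<alpha> (\<lambda>x. x \<bullet> (C *v x) + D \<bullet> x + - trace C) x = f x" for x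
    unfolding ou_generator_def grad_quadratic [OF C_symmetric] laplacian_quadratic [OF C_symmetric] f
    by (simp add: transpose_A)
  moreover have "integrable std_gaussian (\<lambda>x. x \<bullet> (C *v x) + D \<bullet> x + - trace C)"
    "(\<integral>x. x \<bullet> (C *v x) + D \<bullet> x + - trace C \<partial>std_gaussian) = 0"
    using std_gaussian_quadratic [of C] std_gaussian_linear [of D]
    by (simp_all add: prob_space [simplified])
  ultimately show ?thesis
    unfolding eq mean_zero_poisson_solution_def
    using twice_cont_diff_quadratic [OF C_symmetric] by blast
qed

lemma poisson_solution_unique:
  "mean_zero_poisson_solution J \<alpha> f \<psi> \<Longrightarrow> \<psi> = (\<lambda>x. x \<bullet> (C *v x) + D \<bullet> x - trace C)"
  by (rule mean_zero_poisson_solution_unique [OF J _ poisson_solution_quadratic])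

text \<open>Uniqueness turns the definite description into the explicit quadratic. Its gradient is
  \<open>2 C x + D\<close>, so the second moments give
  \<open>8 (C \<bullet> C) + 2 (D \<bullet> D)\<close>, and \<open>lyapunov_inner_self\<close>
  replaces \<open>C \<bullet> C\<close> by half of \<open>C \<bullet> M\<close>.\<close>

lemma asymptotic_variance_eq_inner: "asymptotic_variance J f \<alpha> = 4 * (C \<bullet> M) + 2 * (D \<bullet> D)"
proof -
  interpret prob_space "std_gaussian :: (real^'d) measure" by (rule prob_space_std_gaussian)
  have "(THE \<phi>. mean_zero_poisson_solution J \<alpha> f \<phi>) = (\<lambda>x. x \<bullet> (C *v x) + D \<bullet> x - trace C)"
    by (rule the_equality [where P = "mean_zero_poisson_solution J \<alpha> f",
          OF poisson_solution_quadratic poisson_solution_unique])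
  also have "\<dots> = (\<lambda>x. x \<bullet> (C *v x) + D \<bullet> x + - trace C)" by simp
  finally have the_eq: "(THE \<phi>. mean_zero_poisson_solution J \<alpha> f \<phi>) = \<dots>" .
  have "asymptotic_variance J f \<alpha> = 2 * (\<integral>x. (norm (2 *\<^sub>R (C *v x) + D))\<^sup>2 \<partial>std_gaussian)"
    unfolding asymptotic_variance_def the_eq grad_quadratic [OF C_symmetric] ..
  also have "\<dots> = 2 * (\<integral>x. 4 * (x \<bullet> ((C ** C) *v x)) + 4 * ((C *v D) \<bullet> x) + D \<bullet> D \<partial>std_gaussian)"
  proof -
    have "(C *v x) \<bullet> y = x \<bullet> (C *v y)" for x y
      using transpose_inner [of C x y] by (simp add: C_symmetric)
    then have "(norm (2 *\<^sub>R (C *v x) + D))\<^sup>2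
        = 4 * (x \<bullet> ((C ** C) *v x)) + 4 * ((C *v D) \<bullet> x) + D \<bullet> D" for x
      unfolding power2_norm_eq_inner
      by (simp add: inner_add_left inner_add_right inner_commute matrix_vector_mul_assoc [symmetric])
    then show ?thesis by simp
  qed
  also have "\<dots> = 2 * (4 * trace (C ** C) + D \<bullet> D)"
    using std_gaussian_quadratic [of "C ** C"] std_gaussian_linear [of "C *v D"]
    by (simp add: prob_space [simplified])
  also have "trace (C ** C) = C \<bullet> C" by (simp add: matrix_inner_eq_trace C_symmetric)
  also have "C \<bullet> C = C \<bullet> M / 2" using lyapunov_inner_self [OF J A, of M] by (simp add: C)
  finally show ?thesis by simp
qed

text \<open>The matrix to be inverted factors as \<open>A A^T\<close>. If \<open>y\<close> is its
  inverse applied to \<open>l\<close>, cancelling \<open>A\<close> in \<open>A A^T y = A D\<close>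
  gives \<open>A^T y = D\<close>, and hence
  \<open>D \<bullet> D = y \<bullet> (A D) = y \<bullet> l\<close>.\<close>

lemma D_inner: "D \<bullet> D = l \<bullet> (matrix_inv (mat 1 + \<alpha>\<^sup>2 *\<^sub>R (transpose J ** J)) *v l)"
proof -
  let ?N = "mat 1 + \<alpha>\<^sup>2 *\<^sub>R (transpose J ** J)"
  have N: "?N = A ** transpose A"
    unfolding transpose_A unfolding A_eq
    by (simp add: matrix_mult_simps J power2_eq_square algebra_simps)
  have inv: "invertible A" using invertible_drift [OF J] by (simp add: A_eq)
  then have "invertible ?N" unfolding N by (intro invertible_mult transpose_invertible)
  define y where "y = matrix_inv ?N *v l"
  have "?N *v y = l" unfolding y_def by (rule matrix_inv_mult_vec) fact
  then have "A *v (transpose A *v y) = A *v D"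
    by (simp only: N matrix_vector_mul_assoc A_mult_D)
  then have "transpose A *v y = D"
    using inv by (metis inj_matrix_vector_mult injD)
  then have "D \<bullet> D = y \<bullet> (A *v D)" using transpose_inner [of A y D] by simp
  then show ?thesis by (simp add: A_mult_D y_def inner_commute)
qed

text \<open>Pythagoras: \<open>l\<close> is \<open>D\<close> minus a multiple of \<open>J D\<close>,
  and these two vectors are orthogonal.\<close>

lemma D_inner_le: "D \<bullet> D \<le> l \<bullet> l"
proof -
  have "l = D - \<alpha> *\<^sub>R (J *v D)"
    using A_mult_D
    by (simp add: A_eq matrix_vector_mult_diff_rdistrib scaleR_matrix_vector_assoc [symmetric])
  then have "l \<bullet> l = D \<bullet> D + \<alpha>\<^sup>2 * ((J *v D) \<bullet> (J *v D))"
    using antisymmetric_quadratic_eq_0 [OF J, of D]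
    by (simp add: inner_diff_left inner_diff_right inner_commute power2_eq_square)
  then show ?thesis by simp
qed

lemma asymptotic_variance_formula:
  "asymptotic_variance J f \<alpha> =
        2 * (frobenius_norm M)\<^sup>2
        - 2 * (LINT s:{0..}|lborel.
                 exp (- 2 * s) * (frobenius_norm (commutator M (mat_exp (- (\<alpha> * s) *\<^sub>R J))))\<^sup>2)
        + 2 * (D \<bullet> D)"
  unfolding asymptotic_variance_eq_inner frobenius_norm_sq [of M]
  unfolding C lyapunov_inner [OF J A] by (simp add: field_simps)

end

text \<open>The normalization differs from the opening English statement: \<open>C\<close> has no
  prefactor 1/2, and the first two variance terms carry a factor 2. This is forced by the equation
  \<open>A C + C A^T = M\<close>: for \<alpha> = 0 it gives \<open>C = M / 2\<close>, and for
  \<open>l = 0\<close> the variance is then \<open>2 |M|^2\<close> in the Frobenius norm.\<close>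

theorem proposition1:
  fixes J M A C :: "real ^ 'd ^ 'd" and l D :: "real ^ 'd" and \<alpha> :: real
    and f :: "real ^ 'd \<Rightarrow> real"
  assumes J: "transpose J = - J"
    and M_sym: "transpose M = M"
    and M_pos: "\<And>x. x \<noteq> 0 \<Longrightarrow> x \<bullet> (M *v x) > 0"
    and f: "f = (\<lambda>x. x \<bullet> (M *v x) + l \<bullet> x - trace M)"
    and A: "A = transpose (mat 1 + \<alpha> *\<^sub>R J)"
    and C: "C = (LINT s:{0..}|lborel.
                   mat_exp (- s *\<^sub>R A) ** M ** mat_exp (- s *\<^sub>R transpose A))"
    and D: "D = matrix_inv A *v l"
  shows "mean_zero_poisson_solution J \<alpha> f (\<lambda>x. x \<bullet> (C *v x) + D \<bullet> x - trace C)
    \<and> (\<forall>\<psi>. mean_zero_poisson_solution J \<alpha> f \<psi>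
             \<longrightarrow> \<psi> = (\<lambda>x. x \<bullet> (C *v x) + D \<bullet> x - trace C))
    \<and> asymptotic_variance J f \<alpha> =
        2 * (frobenius_norm M)\<^sup>2
        - 2 * (LINT s:{0..}|lborel.
                 exp (- 2 * s) * (frobenius_norm (commutator M (mat_exp (- (\<alpha> * s) *\<^sub>R J))))\<^sup>2)
        + 2 * (l \<bullet> (matrix_inv (mat 1 + \<alpha>\<^sup>2 *\<^sub>R (transpose J ** J)) *v l))
    \<and> asymptotic_variance J f \<alpha> \<le> asymptotic_variance J f 0"
proof (intro conjI allI impI)
  note ctx = J M_sym f A C D
  show "mean_zero_poisson_solution J \<alpha> f (\<lambda>x. x \<bullet> (C *v x) + D \<bullet> x - trace C)"
    by (rule poisson_solution_quadratic [OF ctx])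
  show "\<psi> = (\<lambda>x. x \<bullet> (C *v x) + D \<bullet> x - trace C)" if "mean_zero_poisson_solution J \<alpha> f \<psi>" for \<psi>
    by (rule poisson_solution_unique [OF ctx that])
  let ?I = "LINT s:{0..}|lborel.
                 exp (- 2 * s) * (frobenius_norm (commutator M (mat_exp (- (\<alpha> * s) *\<^sub>R J))))\<^sup>2"
  note variance = asymptotic_variance_formula [OF ctx]
  then show "asymptotic_variance J f \<alpha> = 2 * (frobenius_norm M)\<^sup>2 - 2 * ?I
      + 2 * (l \<bullet> (matrix_inv (mat 1 + \<alpha>\<^sup>2 *\<^sub>R (transpose J ** J)) *v l))"
    by (simp only: D_inner [OF ctx])
  have "0 \<le> ?I"
    unfolding set_lebesgue_integral_def by (intro Bochner_Integration.integral_nonneg) auto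
  \<comment> \<open>At \<alpha> = 0 the exponential is the identity, so the commutator vanishes, and
    the drift matrix is the identity, so its vector \<open>D\<close> is \<open>l\<close>. The
    inequality then separates into a nonnegative commutator integral and
    \<open>D_inner_le\<close>.\<close>
  moreover have "asymptotic_variance J f 0 = 2 * (frobenius_norm M)\<^sup>2 + 2 * (l \<bullet> l)"
  proof -
    have "matrix_inv (mat 1 :: real^'d^'d) *v l = l"
      using matrix_inv_mult_vec [of "mat 1 :: real^'d^'d" l]
      by (auto simp: invertible_def)
    then show ?thesis
      using asymptotic_variance_formula [OF J M_sym f refl [of "transpose (mat 1 + 0 *\<^sub>R J)"] refl refl]
      by (simp add: commutator_def frobenius_norm_sq transpose_mat)
  qed
  moreover note D_inner_le [OF ctx]
  ultimately show "asymptotic_variance J f \<alpha> \<le> asymptotic_variance J f 0"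
    unfolding variance by linarith
qed

end
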